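(* Let $\eta$ be a noise such that $G*\eta\in\mathcal M_b$ almost surely, and let $X(t,\mathbf x)=\sum_{j=0}^\infty(-\lambda)^jX_j(t,\mathbf x)$ be an expansion of $X$ in the sense of formal power series in $\lambda$. Then the perturbative solution of $$\partial_tX=\Delta X-m_0^2X-\lambda X^p+\eta\quad (t>0),\qquad X(0,\mathbf x)=f(\mathbf x),$$ is given by $$X_0(t,\mathbf x)=(G*\eta)(t,\mathbf x)+(\tilde G_t\star f)(\mathbf x),$$ $$X_j(t,\mathbf x)=\Big(G*\sum_{(n_0,n_1,\dots)\in B^j_p}\frac{p!}{n_0!\,n_1!\cdots}\prod_{i\ge0}X_i^{n_i}\Big)(t,\mathbf x),\qquad j\ge1,$$ where $B_p^j=\{(n_0,n_1,\dots): n_i\in\mathbb Z_{\ge0},\ \sum_{i\ge0}n_i=p,\ \sum_{i\ge0}i\,n_i=j-1\}$, and $X_j\in\mathcal M_b$ almost surely for every $j\ge0$.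
   Context: Fix integers $d,p\ge1$ and reals $\delta>0$, $m_0>0$. Let $L_\delta=\delta\mathbb Z^d$ and $\Gamma=\mathbb R\times L_\delta$, with points $x=(t,\mathbf x)$ and $|x|^2=t^2+|\mathbf x|^2$. Put $\int g(\mathbf x)\,d\mathbf x=\sum_{\mathbf x\in L_\delta}\delta^dg(\mathbf x)$ and $\int g(x)\,dx=\sum_{\mathbf x\in L_\delta}\delta^d\int_{\mathbb R}g(t,\mathbf x)\,dt$. Convolutions: $(g*h)(x)=\int g(x-y)h(y)\,dy$ on $\Gamma$ and $(g\star h)(\mathbf x)=\int g(\mathbf x-\mathbf y)h(\mathbf y)\,d\mathbf y$ on $L_\delta$. Lattice Laplacian: $\Delta g(\mathbf x)=\delta^{-2}\big[-2d\,g(\mathbf x)+\sum_{|\mathbf y-\mathbf x|=\delta}g(\mathbf y)\big]$. Let $\mu^2(\mathbf p)=2\delta^{-2}\big(d-\sum_{j=1}^d\cos(\delta p_j)\big)+m_0^2$, $\tilde G_t(\mathbf x)=(2\pi)^{-d}\int_{[0,2\pi/\delta]^d}e^{-i\mathbf p\cdot\mathbf x}e^{-t\mu^2(\mathbf p)}\,d\mathbf p$ for $t\ge0$, and $G(t,\mathbf x)=\theta(t)\tilde G_t(\mathbf x)$ with $\theta(t)=1$ if $t>0$ and $\theta(t)=0$ otherwise; $G$ is the Green function of $\partial_t-\Delta+m_0^2$ vanishing for $t<0$. $S(L_\delta)$ and $S(\Gamma)$ are the Schwartz spaces of rapidly decreasing functions, $S'(\Gamma)$ the tempered distributions on $\Gamma$.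 $f\in S(L_\delta)$ is the deterministic initial condition. The noise $\eta$ is a random element of $S'(\Gamma)$ supported in $\{t\ge0\}$; $G*\eta$ is the random distribution $(G*\eta)(\varphi)=\eta\big(\int G(x-\cdot)\varphi(x)\,dx\big)$, $\varphi\in S(\Gamma)$, and $G*\eta\in\mathcal M_b$ means that it is represented by a function in $\mathcal M_b$. The term $(\tilde G_t\star f)(\mathbf x)$ is understood to be $0$ for $t\le0$. $\mathcal M_b$ is the space of measurable $g:\Gamma\to\mathbb R$ such that for every $k\in\mathbb N$ there is $N\in\mathbb N$ with $\int\frac{|g(x)|^k}{(1+|x|^2)^N}\,dx<\infty$. A perturbative solution is a formal power series $X=\sum_{j\ge0}(-\lambda)^jX_j$ satisfying, coefficient by coefficient in $\lambda$, the integrated equation $X=-\lambda\,G*(X^p)+G*\eta+\tilde G_t\star f$. *)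

theory Defs
  imports
    "HOL-Analysis.Analysis"
    "HOL-Probability.Probability"
    "HOL-Computational_Algebra.Formal_Power_Series"
begin

section \<open>Lattice and space-time\<close>

text \<open>
  The dimension \<open>d\<close> is \<open>CARD('d)\<close>. Functions on the lattice or on space-time are total functions on
  the ambient Euclidean space, of which only the values on the lattice (on space-time) are ever used.
\<close>

definition lattice :: "real \<Rightarrow> (real ^ 'd) set" where
  "lattice \<delta> = {x. \<exists>n :: int ^ 'd. x = (\<chi> i. \<delta> * of_int (n $ i))}"

definition Gam :: "real \<Rightarrow> (real \<times> (real ^ 'd)) set" where
  "Gam \<delta> = UNIV \<times> lattice \<delta>"

definition lattice_measure :: "real \<Rightarrow> (real ^ 'd) measure" where
  "lattice_measure \<delta> = scale_measure (ennreal (\<delta> ^ CARD('d))) (count_space (lattice \<delta>))"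

definition Gam_measure :: "real \<Rightarrow> (real \<times> (real ^ 'd)) measure" where
  "Gam_measure \<delta> = lborel \<Otimes>\<^sub>M lattice_measure \<delta>"

lemma space_Gam_measure: "space (Gam_measure \<delta>) = Gam \<delta>"
  by (simp add: Gam_measure_def Gam_def lattice_measure_def space_pair_measure space_scale_measure)

definition conv ::
  "real \<Rightarrow> (real \<times> (real ^ 'd) \<Rightarrow> real) \<Rightarrow> (real \<times> (real ^ 'd) \<Rightarrow> real) \<Rightarrow> real \<times> (real ^ 'd) \<Rightarrow> real" where
  "conv \<delta> g h x = (\<integral>y. g (x - y) * h y \<partial>Gam_measure \<delta>)"

definition lattice_conv ::
  "real \<Rightarrow> (real ^ 'd \<Rightarrow> real) \<Rightarrow> (real ^ 'd \<Rightarrow> real) \<Rightarrow> real ^ 'd \<Rightarrow> real" where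
  "lattice_conv \<delta> g h x = (\<integral>y. g (x - y) * h y \<partial>lattice_measure \<delta>)"


section \<open>Green function\<close>

definition mu2 :: "real \<Rightarrow> real \<Rightarrow> real ^ 'd \<Rightarrow> real" where
  "mu2 \<delta> m0 p = 2 / \<delta>\<^sup>2 * (real CARD('d) - (\<Sum>j\<in>UNIV. cos (\<delta> * p $ j))) + m0\<^sup>2"

definition heat_kernel_complex :: "real \<Rightarrow> real \<Rightarrow> real \<Rightarrow> real ^ 'd \<Rightarrow> complex" where
  "heat_kernel_complex \<delta> m0 t x = of_real (1 / (2 * pi) ^ CARD('d)) *
     (CLINT p : cbox 0 (\<chi> i. 2 * pi / \<delta>) | lborel.
        exp (- \<i> * of_real (p \<bullet> x)) * of_real (exp (- t * mu2 \<delta> m0 p)))"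

text \<open>
  On the lattice the imaginary part of the Fourier integral vanishes
  (\<open>heat_kernel_complex_eq\<close> below), so taking the real part only changes the type.
\<close>

definition heat_kernel :: "real \<Rightarrow> real \<Rightarrow> real \<Rightarrow> real ^ 'd \<Rightarrow> real" where
  "heat_kernel \<delta> m0 t x = Re (heat_kernel_complex \<delta> m0 t x)"

lemma lborel_integral_reflect:
  fixes F :: "'a :: euclidean_space \<Rightarrow> complex"
  assumes [measurable]: "F \<in> borel_measurable borel"
  shows "(\<integral>p. F (c - p) \<partial>lborel) = (\<integral>p. F p \<partial>lborel)"
proof -
  have "distr lborel borel (\<lambda>p :: 'a. c - p) = lborel"
    using lborel_affine[of "- 1" c] by (simp add: density_1)
  then have "(\<integral>p. F p \<partial>lborel) = (\<integral>p. F p \<partial>distr lborel borel (\<lambda>p. c - p))"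
    by (simp only:)
  also have "\<dots> = (\<integral>p. F (c - p) \<partial>lborel)"
    by (rule integral_distr) auto
  finally show ?thesis ..
qed

lemma heat_kernel_complex_eq:
  fixes x :: "real ^ 'd"
  assumes "\<delta> > 0" and "x \<in> lattice \<delta>"
  shows "heat_kernel_complex \<delta> m0 t x = of_real (heat_kernel \<delta> m0 t x)"
proof -
  define c :: "real ^ 'd" where "c = (\<chi> i. 2 * pi / \<delta>)"
  define F where "F = (\<lambda>p :: real ^ 'd. indicat_real (cbox 0 c) p *\<^sub>R
     (exp (- \<i> * of_real (p \<bullet> x)) * of_real (exp (- t * mu2 \<delta> m0 p))))"
  obtain n :: "int ^ 'd" where n: "x = (\<chi> i. \<delta> * of_int (n $ i))"
    using assms(2) by (auto simp: lattice_def)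
  have cx: "c \<bullet> x = 2 * pi * of_int (\<Sum>i\<in>UNIV. n $ i)"
    using assms(1) by (simp add: c_def n inner_vec_def sum_distrib_left mult.assoc)
  have mu: "mu2 \<delta> m0 (c - p) = mu2 \<delta> m0 p" for p :: "real ^ 'd"
  proof -
    have "cos (\<delta> * (c - p) $ j) = cos (\<delta> * p $ j)" for j
      using assms(1) by (simp add: c_def right_diff_distrib cos_diff)
    then show ?thesis by (simp add: mu2_def)
  qed
  have ex: "exp (- \<i> * of_real ((c - p) \<bullet> x)) = cnj (exp (- \<i> * of_real (p \<bullet> x)))" for p
  proof -
    have "exp (- \<i> * of_real ((c - p) \<bullet> x)) = exp (\<i> * of_real (p \<bullet> x)) * exp (- \<i> * of_real (c \<bullet> x))"
      unfolding exp_add[symmetric] by (simp add: inner_diff_left right_diff_distrib)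
    also have "exp (- \<i> * of_real (c \<bullet> x)) = 1"
    proof -
      have "Re (- \<i> * of_real (c \<bullet> x)) = 0"
        by simp
      moreover have "Im (- \<i> * of_real (c \<bullet> x)) = of_int (2 * (- (\<Sum>i\<in>UNIV. n $ i))) * pi"
        unfolding cx by (simp only: of_int_mult of_int_minus) simp
      ultimately show ?thesis
        unfolding exp_eq_1 by blast
    qed
    also have "exp (\<i> * of_real (p \<bullet> x)) = cnj (exp (- \<i> * of_real (p \<bullet> x)))"
      by (simp add: exp_cnj)
    finally show ?thesis by simp
  qed
  have "(c - p \<in> cbox 0 c) = (p \<in> cbox 0 c)" for p
    by (auto simp: mem_box_cart)
  then have "F (c - p) = cnj (F p)" for p
    using ex[of p] by (simp add: F_def mu indicator_def)
  moreover have F_meas: "F \<in> borel_measurable borel"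
    unfolding F_def mu2_def by measurable
  ultimately have "(\<integral>p. F p \<partial>lborel) = cnj (\<integral>p. F p \<partial>lborel)"
    using lborel_integral_reflect[of F c] F_meas by (simp add: Bochner_Integration.integral_cnj)
  then have "(\<integral>p. F p \<partial>lborel) \<in> \<real>"
    by (simp add: Reals_cnj_iff)
  then have "heat_kernel_complex \<delta> m0 t x \<in> \<real>"
    unfolding heat_kernel_complex_def set_lebesgue_integral_def F_def c_def by simp
  then show ?thesis
    by (simp add: heat_kernel_def)
qed

text \<open>Space-time points are pairs \<open>(t, x)\<close>; the norm of the product type is the Euclidean one.\<close>

definition green :: "real \<Rightarrow> real \<Rightarrow> real \<times> (real ^ 'd) \<Rightarrow> real" where
  "green \<delta> m0 = (\<lambda>(t, x). if t > 0 then heat_kernel \<delta> m0 t x else 0)"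

definition initial_term :: "real \<Rightarrow> real \<Rightarrow> (real ^ 'd \<Rightarrow> real) \<Rightarrow> real \<times> (real ^ 'd) \<Rightarrow> real" where
  "initial_term \<delta> m0 f = (\<lambda>(t, x). if t > 0 then lattice_conv \<delta> (heat_kernel \<delta> m0 t) f x else 0)"


section \<open>Function spaces and tempered distributions\<close>

definition schwartz_lattice :: "real \<Rightarrow> (real ^ 'd \<Rightarrow> real) set" where
  "schwartz_lattice \<delta> = {f. \<forall>N :: nat. \<exists>C. \<forall>x\<in>lattice \<delta>. (1 + (norm x)\<^sup>2) ^ N * \<bar>f x\<bar> \<le> C}"

definition time_deriv :: "nat \<Rightarrow> (real \<times> (real ^ 'd) \<Rightarrow> real) \<Rightarrow> real \<times> (real ^ 'd) \<Rightarrow> real" where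
  "time_deriv k \<phi> = (\<lambda>(t, x). (deriv ^^ k) (\<lambda>s. \<phi> (s, x)) t)"

definition schwartz :: "real \<Rightarrow> (real \<times> (real ^ 'd) \<Rightarrow> real) set" where
  "schwartz \<delta> = {\<phi>.
     (\<forall>k. \<forall>(t, x)\<in>Gam \<delta>. (\<lambda>s. time_deriv k \<phi> (s, x)) field_differentiable (at t)) \<and>
     (\<forall>k N. \<exists>C. \<forall>x\<in>Gam \<delta>. (1 + (norm x)\<^sup>2) ^ N * \<bar>time_deriv k \<phi> x\<bar> \<le> C)}"

definition schwartz_seminorm :: "real \<Rightarrow> nat \<Rightarrow> nat \<Rightarrow> (real \<times> (real ^ 'd) \<Rightarrow> real) \<Rightarrow> real" where
  "schwartz_seminorm \<delta> k N \<phi> = (SUP x\<in>Gam \<delta>. (1 + (norm x)\<^sup>2) ^ N * \<bar>time_deriv k \<phi> x\<bar>)"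

text \<open>
  Continuity for the Frechet topology is expressed by a bound by finitely many seminorms. The
  seminorms see only the values on space-time, so by linearity and this bound a tempered
  distribution takes the same value on test functions that agree on space-time.
\<close>

definition tempered :: "real \<Rightarrow> ((real \<times> (real ^ 'd) \<Rightarrow> real) \<Rightarrow> real) set" where
  "tempered \<delta> = {u.
     (\<forall>\<phi>\<in>schwartz \<delta>. \<forall>\<psi>\<in>schwartz \<delta>. \<forall>a b. u (\<lambda>x. a * \<phi> x + b * \<psi> x) = a * u \<phi> + b * u \<psi>) \<and>
     (\<exists>C n. \<forall>\<phi>\<in>schwartz \<delta>. \<bar>u \<phi>\<bar> \<le> C * (\<Sum>k\<le>n. \<Sum>N\<le>n. schwartz_seminorm \<delta> k N \<phi>))}"

definition supported_in ::
  "real \<Rightarrow> ((real \<times> (real ^ 'd) \<Rightarrow> real) \<Rightarrow> real) \<Rightarrow> (real \<times> (real ^ 'd)) set \<Rightarrow> bool" where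
  "supported_in \<delta> u F \<longleftrightarrow>
     (\<forall>\<phi>\<in>schwartz \<delta>. closure {x \<in> Gam \<delta>. \<phi> x \<noteq> 0} \<inter> F = {} \<longrightarrow> u \<phi> = 0)"

definition Mb :: "real \<Rightarrow> (real \<times> (real ^ 'd) \<Rightarrow> real) set" where
  "Mb \<delta> = {g \<in> borel_measurable (Gam_measure \<delta>).
     \<forall>k :: nat. \<exists>N :: nat. (\<integral>\<^sup>+x. ennreal (\<bar>g x\<bar> ^ k / (1 + (norm x)\<^sup>2) ^ N) \<partial>Gam_measure \<delta>) < \<infinity>}"

definition represents ::
  "real \<Rightarrow> (real \<times> (real ^ 'd) \<Rightarrow> real) \<Rightarrow> ((real \<times> (real ^ 'd) \<Rightarrow> real) \<Rightarrow> real) \<Rightarrow> bool" where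
  "represents \<delta> g u \<longleftrightarrow>
     (\<forall>\<phi>\<in>schwartz \<delta>. integrable (Gam_measure \<delta>) (\<lambda>x. g x * \<phi> x) \<and>
                    u \<phi> = (\<integral>x. g x * \<phi> x \<partial>Gam_measure \<delta>))"

definition green_conv_dist ::
  "real \<Rightarrow> real \<Rightarrow> ((real \<times> (real ^ 'd) \<Rightarrow> real) \<Rightarrow> real) \<Rightarrow> (real \<times> (real ^ 'd) \<Rightarrow> real) \<Rightarrow> real" where
  "green_conv_dist \<delta> m0 u \<phi> = u (\<lambda>y. \<integral>x. green \<delta> m0 (x - y) * \<phi> x \<partial>Gam_measure \<delta>)"

text \<open>
  A random element of the space of tempered distributions is a map into it whose evaluations at
  test functions are random variables.
\<close>

definition noise ::
  "real \<Rightarrow> 'w measure \<Rightarrow> ('w \<Rightarrow> (real \<times> (real ^ 'd) \<Rightarrow> real) \<Rightarrow> real) \<Rightarrow> bool" where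
  "noise \<delta> M \<eta> \<longleftrightarrow>
     (\<forall>\<omega>\<in>space M. \<eta> \<omega> \<in> tempered \<delta>) \<and>
     (\<forall>\<phi>\<in>schwartz \<delta>. (\<lambda>\<omega>. \<eta> \<omega> \<phi>) \<in> borel_measurable M) \<and>
     (AE \<omega> in M. supported_in \<delta> (\<eta> \<omega>) {(t, x). t \<ge> 0})"


section \<open>Perturbative solutions\<close>

text \<open>
  \<open>coupling_series X x\<close> is the formal power series \<open>\<Sum>j. (-\<lambda>)^j X\<^sub>j(x)\<close> at the point \<open>x\<close>; the formal
  variable \<open>\<lambda>\<close> is \<open>fps_X\<close>.
\<close>

definition coupling_series ::
  "(nat \<Rightarrow> real \<times> (real ^ 'd) \<Rightarrow> real) \<Rightarrow> real \<times> (real ^ 'd) \<Rightarrow> real fps" where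
  "coupling_series X x = Abs_fps (\<lambda>j. (- 1) ^ j * X j x)"

text \<open>
  The integrated equation \<open>X = - \<lambda> G * (X^p) + G * \<eta> + G\<^sub>t \<star> f\<close>, where \<open>g\<close> is the function
  representing \<open>G * \<eta>\<close> and the convolution with \<open>G\<close> acts coefficientwise. That the convolutions
  converge absolutely is part of the definition, because divergent Bochner integrals are \<open>0\<close>.
\<close>

definition perturbative_solution ::
  "real \<Rightarrow> real \<Rightarrow> nat \<Rightarrow> (real ^ 'd \<Rightarrow> real) \<Rightarrow> (real \<times> (real ^ 'd) \<Rightarrow> real) \<Rightarrow>
   (nat \<Rightarrow> real \<times> (real ^ 'd) \<Rightarrow> real) \<Rightarrow> bool" where
  "perturbative_solution \<delta> m0 p f g X \<longleftrightarrow>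
     (\<forall>k. \<forall>x\<in>Gam \<delta>. integrable (Gam_measure \<delta>)
        (\<lambda>y. green \<delta> m0 (x - y) * fps_nth (coupling_series X y ^ p) k)) \<and>
     (\<forall>x\<in>Gam \<delta>. coupling_series X x =
        - fps_X * Abs_fps (\<lambda>k. conv \<delta> (green \<delta> m0) (\<lambda>y. fps_nth (coupling_series X y ^ p) k) x)
        + fps_const (g x) + fps_const (initial_term \<delta> m0 f x))"

definition B_idx :: "nat \<Rightarrow> nat \<Rightarrow> (nat \<Rightarrow> nat) set" where
  "B_idx p j = {n. finite {i. n i \<noteq> 0} \<and> (\<Sum>i | n i \<noteq> 0. n i) = p \<and>
               int (\<Sum>i | n i \<noteq> 0. i * n i) = int j - 1}"

lemma finite_B_idx: "finite (B_idx p j)"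
proof (rule finite_subset)
  show "B_idx p j \<subseteq> {n. \<forall>i. (i \<in> {..j} \<longrightarrow> n i \<in> {..p}) \<and> (i \<notin> {..j} \<longrightarrow> n i = 0)}"
  proof (intro subsetI CollectI allI)
    fix n i
    assume n: "n \<in> B_idx p j"
    have "n i \<le> p \<and> i * n i < j" if "n i \<noteq> 0"
    proof -
      have fin: "finite {i. n i \<noteq> 0}" and i: "i \<in> {i. n i \<noteq> 0}"
        using n that by (auto simp: B_idx_def)
      have "n i \<le> (\<Sum>i | n i \<noteq> 0. n i)" "i * n i \<le> (\<Sum>i | n i \<noteq> 0. i * n i)"
        using member_le_sum[OF i _ fin, of n] member_le_sum[OF i _ fin, of "\<lambda>i. i * n i"] by auto
      moreover have "(\<Sum>i | n i \<noteq> 0. n i) = p" "int (\<Sum>i | n i \<noteq> 0. i * n i) = int j - 1"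
        using n unfolding B_idx_def by blast+
      ultimately show ?thesis by linarith
    qed
    moreover have "i \<le> i * n i" if "n i \<noteq> 0"
      using that by simp
    ultimately have "n i \<noteq> 0 \<Longrightarrow> n i \<le> p \<and> i \<le> j"
      by (meson le_less_trans less_imp_le)
    then show "(i \<in> {..j} \<longrightarrow> n i \<in> {..p}) \<and> (i \<notin> {..j} \<longrightarrow> n i = 0)"
      by (cases "n i = 0") auto
  qed
  show "finite {n :: nat \<Rightarrow> nat. \<forall>i. (i \<in> {..j} \<longrightarrow> n i \<in> {..p}) \<and> (i \<notin> {..j} \<longrightarrow> n i = 0)}"
    by (rule finite_set_of_finite_funs) auto
qed

definition multinomial_term ::
  "nat \<Rightarrow> (nat \<Rightarrow> nat) \<Rightarrow> (nat \<Rightarrow> real \<times> (real ^ 'd) \<Rightarrow> real) \<Rightarrow> real \<times> (real ^ 'd) \<Rightarrow> real" where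
  "multinomial_term p n X y =
     fact p / (\<Prod>i | n i \<noteq> 0. fact (n i)) * (\<Prod>i | n i \<noteq> 0. X i y ^ n i)"

end

theory Submission
  imports Defs
begin

text \<open>
  The coefficient of \<open>\<lambda>\<^sup>k\<close> in \<open>X\<^sup>p\<close> is given by the multinomial theorem, so comparing coefficients in
  the integrated equation yields the recursion, in which \<open>X\<^sub>j\<close> depends only on the \<open>X\<^sub>i\<close> with \<open>i < j\<close>.
  It remains to see that all convolutions converge at every point, which needs only that the noise
  term lies in \<open>Mb\<close>. Since \<open>Mb\<close> is an algebra, it suffices that \<open>G * h\<close> converges everywhere and
  grows at most polynomially for \<open>h\<close> in \<open>Mb\<close>. On the lattice the heat kernel has no singularity at
  \<open>t = 0\<close>: expanding \<open>exp (2 t / \<delta>\<^sup>2 * \<Sum>\<^sub>j cos (\<delta> p\<^sub>j))\<close> in its power series, the \<open>n\<close>-th term contributes to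
  \<open>G\<^sub>t (\<delta> m)\<close> only if \<open>n \<ge> \<bar>m\<^sub>k\<bar>\<close> for all \<open>k\<close>, and the tails of the exponential series give joint
  exponential decay in \<open>t\<close> and \<open>x\<close>. Peetre's inequality turns this into
  \<open>\<bar>G (x - y)\<bar> \<le> C (1 + \<bar>x\<bar>\<^sup>2)\<^sup>N (1 + \<bar>y\<bar>\<^sup>2)\<^sup>-\<^sup>N\<close>, which gives both claims at once.
\<close>

section \<open>Powers of formal power series\<close>

lemma B_idx_sum:
  assumes "n \<in> B_idx p (Suc k)"
  shows "(\<Sum>i | n i \<noteq> 0. i * n i) = k"
proof -
  have "int (\<Sum>i | n i \<noteq> 0. i * n i) = int (Suc k) - 1"
    using assms unfolding B_idx_def by blast
  then show ?thesis
    by linarith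
qed

text \<open>This makes the recursion well founded: an index \<open>i\<close> that occurs contributes
  at least \<open>i\<close> to a sum that equals \<open>j - 1\<close>.\<close>

lemma B_idx_lt:
  assumes "n \<in> B_idx p j" and "n i \<noteq> 0"
  shows "i < j"
proof -
  have fin: "finite {i. n i \<noteq> 0}" and i: "i \<in> {i. n i \<noteq> 0}"
    using assms by (auto simp: B_idx_def)
  have "i \<le> i * n i"
    using assms by simp
  also have "\<dots> \<le> (\<Sum>i | n i \<noteq> 0. i * n i)"
    using member_le_sum[OF i _ fin, of "\<lambda>i. i * n i"] by simp
  also have "\<dots> < j"
  proof -
    have "int (\<Sum>i | n i \<noteq> 0. i * n i) = int j - 1"
      using assms(1) unfolding B_idx_def by blast
    then show ?thesis
      by linarith
  qed
  finally show ?thesis .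
qed

lemma sum_mset_sum_count:
  fixes A :: "nat multiset"
  shows "sum_mset A = (\<Sum>i\<in>set_mset A. i * count A i)"
proof -
  obtain xs where "A = mset xs"
    using ex_mset by metis
  then show ?thesis
    using sum_list_map_eq_sum_count[of "\<lambda>x. x" xs]
    by (simp add: sum_mset_sum_list count_mset mult.commute)
qed

text \<open>Expanding the power gives a sum over lists \<open>v\<close> of length \<open>p\<close>
  with sum \<open>k\<close>, which is then grouped by \<open>count (mset v)\<close>. A fibre
  consists of the permutations of one multiset; the product is constant on it, and its cardinality
  is the multinomial coefficient. The argument \<open>Suc k\<close> compensates the
  \<open>j - 1\<close> in \<open>B_idx\<close>.\<close>

lemma fps_power_nth_multinomial:
  fixes F :: "'a :: field_char_0 fps"
  shows "fps_nth (F ^ p) k =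
    (\<Sum>n\<in>B_idx p (Suc k). fact p / (\<Prod>i | n i \<noteq> 0. fact (n i)) * (\<Prod>i | n i \<noteq> 0. fps_nth F i ^ n i))"
proof -
  let ?w = "\<lambda>v. \<Prod>x\<leftarrow>v. fps_nth F x"
  have fin: "finite (natpermute k p)"
    by (rule natpermute_finite)
  have nth: "fps_nth (F ^ p) k = (\<Sum>v\<in>natpermute k p. ?w v)"
  proof (cases p)
    \<comment> \<open>\<open>fps_power_nth_Suc\<close> treats positive exponents. For
      \<open>p = 0\<close> the only list is the empty one, with sum 0 and product 1.\<close>
    case 0
    then have "natpermute k p = (if k = 0 then {[]} else {})"
      by (auto simp: natpermute_def)
    then show ?thesis
      using 0 by auto
  next
    case (Suc m)
    have "(\<Prod>j\<in>{0..m}. fps_nth F (v ! j)) = ?w v" if "v \<in> natpermute k p" for v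
    proof -
      have "length v = Suc m"
        using that Suc by (simp add: natpermute_def)
      then have "?w v = (\<Prod>j\<in>{0..<Suc m}. map (fps_nth F) v ! j)"
        by (simp add: prod.list_conv_set_nth)
      also have "\<dots> = (\<Prod>j\<in>{0..m}. fps_nth F (v ! j))"
        using \<open>length v = Suc m\<close> by (intro prod.cong) auto
      finally show ?thesis ..
    qed
    then show ?thesis
      unfolding Suc fps_power_nth_Suc by (intro sum.cong) (auto simp: Suc)
  qed
  have img: "(\<lambda>v. count (mset v)) ` natpermute k p \<subseteq> B_idx p (Suc k)"
  proof clarify
    fix v assume v: "v \<in> natpermute k p"
    have S: "{i. count (mset v) i \<noteq> 0} = set_mset (mset v)"
      by (auto simp: count_mset_0_iff)
    have "(\<Sum>i\<in>set_mset (mset v). i * count (mset v) i) = sum_list v"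
      unfolding sum_mset_sum_list[symmetric] sum_mset_sum_count ..
    then show "count (mset v) \<in> B_idx p (Suc k)"
      using v unfolding B_idx_def natpermute_def mem_Collect_eq S size_multiset_overloaded_eq[symmetric]
      by simp
  qed
  have fibre: "(\<Sum>v | v \<in> natpermute k p \<and> count (mset v) = n. ?w v) =
      fact p / (\<Prod>i | n i \<noteq> 0. fact (n i)) * (\<Prod>i | n i \<noteq> 0. fps_nth F i ^ n i)"
    if n: "n \<in> B_idx p (Suc k)" for n
  proof -
    \<comment> \<open>Finite support makes \<open>n\<close> the multiplicity function of a multiset,
      whose size is \<open>p\<close> and whose sum is \<open>k\<close>.\<close>
    define A where "A = Abs_multiset n"
    have cA: "count A = n"
      using n by (simp add: A_def B_idx_def Abs_multiset_inverse)
    have S: "{i. n i \<noteq> 0} = set_mset A"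
      unfolding cA[symmetric] by auto
    have szA: "size A = p"
      using n unfolding B_idx_def S[symmetric] size_multiset_overloaded_eq cA by blast
    have smA: "sum_mset A = k"
      using B_idx_sum[OF n] unfolding sum_mset_sum_count S cA .
    have "count (mset v) = n \<longleftrightarrow> mset v = A" for v
      using cA by (metis count_inject)
    moreover have "mset v = A \<Longrightarrow> v \<in> natpermute k p" for v
      using szA smA by (auto simp: natpermute_def sum_mset_sum_list)
    ultimately have "{v. v \<in> natpermute k p \<and> count (mset v) = n} = permutations_of_multiset A"
      by (auto simp: permutations_of_multiset_def)
    then have "(\<Sum>v | v \<in> natpermute k p \<and> count (mset v) = n. ?w v) =
        (\<Sum>v\<in>permutations_of_multiset A. \<Prod>i\<in>#A. fps_nth F i)"
      by (intro sum.cong) (auto simp: permutations_of_multiset_def prod_mset_prod_list[symmetric])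
    also have "\<dots> = of_nat (card (permutations_of_multiset A)) * (\<Prod>i | n i \<noteq> 0. fps_nth F i ^ n i)"
      unfolding sum_constant image_prod_mset_multiplicity S cA ..
    also have "of_nat (card (permutations_of_multiset A)) = 
        (fact p / (\<Prod>i | n i \<noteq> 0. fact (n i)) :: 'a)"
    proof -
      have "of_nat (card (permutations_of_multiset A)) * (\<Prod>i | n i \<noteq> 0. fact (n i)) = (fact p :: 'a)"
        using arg_cong[OF card_permutations_of_multiset_aux[of A], of "of_nat :: nat \<Rightarrow> 'a"]
        unfolding S cA szA by simp
      moreover have "(\<Prod>i | n i \<noteq> 0. fact (n i) :: 'a) \<noteq> 0"
        unfolding S by simp
      ultimately show ?thesis
        using nonzero_eq_divide_eq by blast
    qed
    finally show ?thesis .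
  qed
  have "fps_nth (F ^ p) k = 
      (\<Sum>n\<in>B_idx p (Suc k). \<Sum>v | v \<in> natpermute k p \<and> count (mset v) = n. ?w v)"
    unfolding nth by (rule sum.group[symmetric, OF fin finite_B_idx img])
  also have "\<dots> = (\<Sum>n\<in>B_idx p (Suc k). fact p / (\<Prod>i | n i \<noteq> 0. fact (n i)) * (\<Prod>i | n i \<noteq> 0. fps_nth F i ^ n i))"
    by (intro sum.cong refl fibre)
  finally show ?thesis .
qed

text \<open>Each factor \<open>X i\<close> carries the sign \<open>(- 1) ^ i\<close>. The constraint
  on the sum of \<open>i * n i\<close> makes the total sign \<open>(- 1) ^ k\<close> for every
  \<open>n\<close>, so it factors out.\<close>

lemma coupling_series_power_nth:
  "fps_nth (coupling_series X y ^ p) k = (- 1) ^ k * (\<Sum>n\<in>B_idx p (Suc k). multinomial_term p n X y)"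
proof -
  have "(\<Prod>i | n i \<noteq> 0. ((- 1) ^ i * X i y) ^ n i) = (- 1) ^ k * (\<Prod>i | n i \<noteq> 0. X i y ^ n i)"
    if "n \<in> B_idx p (Suc k)" for n
  proof -
    have "(\<Prod>i | n i \<noteq> 0. (- 1 :: real) ^ (i * n i)) = (- 1) ^ (\<Sum>i | n i \<noteq> 0. i * n i)"
      by (simp add: power_sum)
    then show ?thesis
      unfolding B_idx_sum[OF that]
      by (simp add: power_mult_distrib prod.distrib power_mult)
  qed
  then show ?thesis
    unfolding fps_power_nth_multinomial multinomial_term_def sum_distrib_left
    by (intro sum.cong refl) (simp add: coupling_series_def)
qed

section \<open>The space-time measure\<close>

lemma space_lattice_measure [simp]: "space (lattice_measure \<delta>) = lattice \<delta>"
  by (simp add: lattice_measure_def space_scale_measure)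

lemma sets_lattice_measure [simp, measurable_cong]: "sets (lattice_measure \<delta>) = Pow (lattice \<delta>)"
  by (simp add: lattice_measure_def)

lemma countable_lattice: "countable (lattice \<delta> :: (real ^ 'd) set)"
proof -
  have "countable (UNIV :: (int ^ 'd) set)"
  proof (rule countable_subset[OF _ countable_image])
    show "UNIV \<subseteq> vec_lambda ` (UNIV :: ('d \<Rightarrow> int) set)"
      by (metis subsetI rangeI vec_nth_inverse)
    show "countable (UNIV :: ('d \<Rightarrow> int) set)"
      by simp
  qed
  moreover have "lattice \<delta> = range (\<lambda>n :: int ^ 'd. \<chi> i. \<delta> * of_int (n $ i))"
    by (auto simp: lattice_def)
  ultimately show ?thesis
    by simp
qed

lemma lattice_diff:
  assumes "x \<in> lattice \<delta>" and "y \<in> lattice \<delta>"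
  shows "x - y \<in> lattice \<delta>"
proof -
  obtain m n where "x = (\<chi> i. \<delta> * of_int (m $ i))" "y = (\<chi> i. \<delta> * of_int (n $ i))"
    using assms by (auto simp: lattice_def)
  then have "x - y = (\<chi> i. \<delta> * of_int ((m - n) $ i))"
    by (simp add: vec_eq_iff algebra_simps)
  then show ?thesis
    unfolding lattice_def by blast
qed

lemma Gam_diff: "x \<in> Gam \<delta> \<Longrightarrow> y \<in> Gam \<delta> \<Longrightarrow> x - y \<in> Gam \<delta>"
  by (auto simp: Gam_def lattice_diff)

text \<open>In this form sigma-finiteness passes over from the counting measure on a countable set,
  since the density is finite.\<close>

lemma lattice_measure_eq_density:
  "lattice_measure \<delta> = density (count_space (lattice \<delta> :: (real ^ 'd) set)) (\<lambda>_. ennreal (\<delta> ^ CARD('d)))"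
  by (rule measure_eqI) (simp_all add: lattice_measure_def emeasure_density_const)

lemma sigma_finite_lattice_measure: "sigma_finite_measure (lattice_measure \<delta> :: (real ^ 'd) measure)"
proof -
  interpret C: sigma_finite_measure "count_space (lattice \<delta> :: (real ^ 'd) set)"
    by (rule sigma_finite_measure_count_space_countable[OF countable_lattice])
  show ?thesis
    unfolding lattice_measure_eq_density by (subst C.sigma_finite_iff_density_finite) auto
qed

lemma nn_integral_lattice_measure:
  fixes g :: "real ^ 'd \<Rightarrow> ennreal"
  shows "(\<integral>\<^sup>+x. g x \<partial>lattice_measure \<delta>) = ennreal (\<delta> ^ CARD('d)) * (\<integral>\<^sup>+x. g x \<partial>count_space (lattice \<delta>))"
  unfolding lattice_measure_def by (rule nn_integral_scale_measure) simp

lemma sigma_finite_Gam_measure: "sigma_finite_measure (Gam_measure \<delta> :: (real \<times> (real ^ 'd)) measure)"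
proof -
  interpret L: sigma_finite_measure "lattice_measure \<delta> :: (real ^ 'd) measure"
    by (rule sigma_finite_lattice_measure)
  interpret pair_sigma_finite "lborel :: real measure" "lattice_measure \<delta> :: (real ^ 'd) measure" ..
  show ?thesis
    unfolding Gam_measure_def by unfold_locales
qed

text \<open>The lattice is countable and carries the discrete sigma-algebra, so measurability can be
  checked on each time line. The coordinates are swapped, and swapped back, to put the countable
  factor first.\<close>

lemma measurable_Gam_measureI:
  fixes h :: "real \<times> (real ^ 'd) \<Rightarrow> 'b"
  assumes "\<And>x. x \<in> lattice \<delta> \<Longrightarrow> (\<lambda>t. h (t, x)) \<in> measurable borel N"
  shows "h \<in> measurable (Gam_measure \<delta>) N"
proof -
  have "(\<lambda>z. h (snd z, fst z)) \<in> measurable (count_space (lattice \<delta>) \<Otimes>\<^sub>M borel) N"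
    using assms by (intro measurable_pair_measure_countable1 countable_lattice) auto
  then have "(\<lambda>z. h (snd (snd z, fst z), fst (snd z, fst z))) \<in> measurable (borel \<Otimes>\<^sub>M count_space (lattice \<delta>)) N"
    by measurable
  moreover have "sets (Gam_measure \<delta>) = sets (borel \<Otimes>\<^sub>M count_space (lattice \<delta> :: (real ^ 'd) set))"
    unfolding Gam_measure_def by (intro sets_pair_measure_cong) auto
  ultimately show ?thesis
    by (simp cong: measurable_cong_sets)
qed

lemma borel_measurable_Gam_measure: 
  fixes g :: "real \<times> (real ^ 'd) \<Rightarrow> real"
  shows "g \<in> borel_measurable borel \<Longrightarrow> g \<in> borel_measurable (Gam_measure \<delta>)"
proof (rule measurable_Gam_measureI)
  fix x :: "real ^ 'd" assume "g \<in> borel_measurable borel"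
  moreover have "(\<lambda>t :: real. (t, x)) \<in> borel_measurable borel"
    by (intro borel_measurable_continuous_onI continuous_intros)
  ultimately show "(\<lambda>t. g (t, x)) \<in> borel_measurable borel"
    using measurable_compose by blast
qed

text \<open>Serves the joint measurability of \<open>green \<delta> m0 (x - y) * h y\<close> in
  \<open>x\<close> and \<open>y\<close>. The time component is a difference of Borel functions; for
  the lattice component every subset of the countable product is measurable.\<close>

lemma measurable_Gam_measure_diff:
  "(\<lambda>z. fst z - snd z) \<in> measurable (Gam_measure \<delta> \<Otimes>\<^sub>M Gam_measure \<delta>) (Gam_measure \<delta> :: (real \<times> (real ^ 'd)) measure)"
proof -
  let ?L = "lattice_measure \<delta> :: (real ^ 'd) measure"
  have "sets (?L \<Otimes>\<^sub>M ?L) = sets (count_space (lattice \<delta>) \<Otimes>\<^sub>M count_space (lattice \<delta> :: (real ^ 'd) set))"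
    by (intro sets_pair_measure_cong) auto
  also have "\<dots> = Pow (lattice \<delta> \<times> lattice \<delta>)"
    by (subst pair_measure_countable[OF countable_lattice countable_lattice]) simp
  finally have sets: "sets (?L \<Otimes>\<^sub>M ?L) = Pow (lattice \<delta> \<times> lattice \<delta>)" .
  have L: "(\<lambda>z. fst z - snd z) \<in> measurable (?L \<Otimes>\<^sub>M ?L) ?L"
  proof (rule measurableI)
    fix A assume "A \<in> sets ?L"
    show "(\<lambda>z. fst z - snd z) -` A \<inter> space (?L \<Otimes>\<^sub>M ?L) \<in> sets (?L \<Otimes>\<^sub>M ?L)"
      unfolding sets by (auto simp: space_pair_measure)
  qed (auto simp: space_pair_measure lattice_diff)
  have "(\<lambda>z. (snd (fst z), snd (snd z))) \<in> measurable (Gam_measure \<delta> \<Otimes>\<^sub>M Gam_measure \<delta>) (?L \<Otimes>\<^sub>M ?L)"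
    unfolding Gam_measure_def
    by (intro measurable_Pair measurable_compose[OF measurable_fst measurable_snd]
        measurable_compose[OF measurable_snd measurable_snd])
  from measurable_compose[OF this L]
  have "(\<lambda>z. snd (fst z) - snd (snd z)) \<in> measurable (Gam_measure \<delta> \<Otimes>\<^sub>M Gam_measure \<delta>) ?L"
    by simp
  moreover have "(\<lambda>z. fst (fst z) - fst (snd z)) \<in> measurable (Gam_measure \<delta> \<Otimes>\<^sub>M Gam_measure \<delta>) (lborel :: real measure)"
  proof -
    have "(\<lambda>z. fst (fst z)) \<in> measurable (Gam_measure \<delta> \<Otimes>\<^sub>M Gam_measure \<delta>) (lborel :: real measure)"
      "(\<lambda>z. fst (snd z)) \<in> measurable (Gam_measure \<delta> \<Otimes>\<^sub>M Gam_measure \<delta>) (lborel :: real measure)"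
      unfolding Gam_measure_def
      by (rule measurable_compose[OF measurable_fst measurable_fst] measurable_compose[OF measurable_snd measurable_fst])+
    then show ?thesis
      unfolding measurable_lborel1 by (rule borel_measurable_diff)
  qed
  ultimately have "(\<lambda>z. (fst (fst z) - fst (snd z), snd (fst z) - snd (snd z)))
      \<in> measurable (Gam_measure \<delta> \<Otimes>\<^sub>M Gam_measure \<delta>) (lborel \<Otimes>\<^sub>M ?L)"
    by (rule measurable_Pair[rotated])
  then show ?thesis
    by (simp only: Gam_measure_def minus_prod_def)
qed

section \<open>The algebra \<open>Mb\<close>\<close>

lemma integrable_count_space_int_weight:
  fixes \<delta> :: real
  assumes "\<delta> > 0"
  shows "integrable (count_space UNIV) (\<lambda>k :: int. 1 / (1 + (\<delta> * of_int k)\<^sup>2))"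
proof -
  define w where "w = (\<lambda>k :: int. 1 / (1 + (\<delta> * of_int k)\<^sup>2))"
  have nat: "Infinite_Set_Sum.abs_summable_on (\<lambda>n. 1 / (1 + (\<delta> * real n)\<^sup>2)) UNIV"
    unfolding abs_summable_on_nat_iff'
  proof (rule summable_comparison_test_ev)
    show "\<forall>\<^sub>F n in sequentially. norm (norm (1 / (1 + (\<delta> * real n)\<^sup>2))) \<le> 1 / \<delta>\<^sup>2 * inverse (real n ^ 2)"
      using eventually_gt_at_top[of 0]
    proof eventually_elim
      case (elim n)
      have "0 < (\<delta> * real n)\<^sup>2"
        using elim assms by simp
      then have "1 / (1 + (\<delta> * real n)\<^sup>2) \<le> 1 / (\<delta> * real n)\<^sup>2"
        by (intro frac_le) simp_all
      also have "\<dots> = 1 / \<delta>\<^sup>2 * inverse (real n ^ 2)"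
        by (simp add: power_mult_distrib divide_inverse)
      finally show ?case
        by simp
    qed
    show "summable (\<lambda>n. 1 / \<delta>\<^sup>2 * inverse (real n ^ 2))"
      by (intro summable_mult inverse_power_summable) simp
  qed
  \<comment> \<open>The weight is even, so summability over the naturals, by comparison with the sum
    of \<open>1 / n^2\<close>, covers both halves of the integers.\<close>
  have "Infinite_Set_Sum.abs_summable_on w (range int \<union> range (\<lambda>n. - int n))"
    by (intro abs_summable_on_union abs_summable_on_reindex) (use nat in \<open>simp_all add: w_def\<close>)
  moreover have "range int \<union> range (\<lambda>n. - int n) = UNIV"
  proof -
    have "k \<in> range int \<union> range (\<lambda>n. - int n)" for k
      by (cases k rule: int_cases2) auto
    then show ?thesis by blast
  qed
  ultimately show ?thesis
    by (simp add: w_def Infinite_Set_Sum.abs_summable_on_def)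
qed

lemma prod_le_one_plus_norm_power:
  fixes x :: "real ^ 'd"
  shows "(\<Prod>i\<in>UNIV. 1 + (x $ i)\<^sup>2) \<le> (1 + (norm x)\<^sup>2) ^ CARD('d)"
proof -
  have "(\<Prod>i\<in>UNIV. 1 + (x $ i)\<^sup>2) \<le> (\<Prod>i\<in>(UNIV :: 'd set). 1 + (norm x)\<^sup>2)"
  proof (intro prod_mono conjI add_left_mono)
    show "(x $ i)\<^sup>2 \<le> (norm x)\<^sup>2" for i
      using component_le_norm_cart[of x i] by (simp add: abs_le_square_iff[symmetric])
  qed simp
  then show ?thesis
    by simp
qed

text \<open>The weight is dominated by the product \<open>w\<close> of one-dimensional weights,
  whose sum over all integer vectors converges because each one-dimensional sum does.\<close>

lemma nn_integral_lattice_weight: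
  assumes "\<delta> > 0"
  shows "(\<integral>\<^sup>+x. ennreal (1 / (1 + (norm x)\<^sup>2) ^ CARD('d)) \<partial>(lattice_measure \<delta> :: (real ^ 'd) measure)) < \<infinity>"
proof -
  define e :: "('d \<Rightarrow> int) \<Rightarrow> real ^ 'd" where "e = (\<lambda>n. \<chi> i. \<delta> * of_int (n i))"
  define w :: "real ^ 'd \<Rightarrow> real" where "w = (\<lambda>x. \<Prod>i\<in>UNIV. 1 / (1 + (x $ i)\<^sup>2))"
  have "range e = lattice \<delta>"
  proof (intro set_eqI iffI)
    fix x :: "real ^ 'd" assume "x \<in> lattice \<delta>"
    then obtain n :: "int ^ 'd" where "x = (\<chi> i. \<delta> * of_int (n $ i))"
      by (auto simp: lattice_def)
    then have "x = e (vec_nth n)"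
      by (simp add: e_def)
    then show "x \<in> range e"
      by blast
  next
    fix x assume "x \<in> range e"
    then obtain n where "x = e n"
      by blast
    then have "x = (\<chi> i. \<delta> * of_int ((\<chi> i. n i) $ i))"
      by (simp add: e_def)
    then show "x \<in> lattice \<delta>"
      unfolding lattice_def by blast
  qed
  have "Infinite_Set_Sum.abs_summable_on (\<lambda>n. \<Prod>i\<in>(UNIV :: 'd set). 1 / (1 + (\<delta> * of_int (n i))\<^sup>2)) (PiE UNIV (\<lambda>_. UNIV :: int set))"
    using integrable_count_space_int_weight[OF assms]
    by (intro abs_summable_on_prod_PiE) (simp_all add: Infinite_Set_Sum.abs_summable_on_def)
  then have "Infinite_Set_Sum.abs_summable_on (\<lambda>n. w (e n)) UNIV"
    by (simp add: w_def e_def PiE_UNIV_domain)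
  then have "Infinite_Set_Sum.abs_summable_on w (lattice \<delta>)"
    unfolding \<open>range e = lattice \<delta>\<close>[symmetric] by (rule abs_summable_on_reindex)
  then have fin: "(\<integral>\<^sup>+x. ennreal (norm (w x)) \<partial>count_space (lattice \<delta>)) < \<infinity>"
    unfolding Infinite_Set_Sum.abs_summable_on_def integrable_iff_bounded by blast
  have "1 / (1 + (norm x)\<^sup>2) ^ CARD('d) \<le> norm (w x)" for x :: "real ^ 'd"
  proof -
    have "w x = 1 / (\<Prod>i\<in>UNIV. 1 + (x $ i)\<^sup>2)"
      by (simp add: w_def prod_dividef)
    moreover have pos: "(\<Prod>i\<in>UNIV. 1 + (x $ i)\<^sup>2) > 0"
      by (intro prod_pos) (simp add: add_pos_nonneg)
    ultimately show ?thesis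
      using prod_le_one_plus_norm_power[of x] by (simp add: frac_le)
  qed
  then have "(\<integral>\<^sup>+x. ennreal (1 / (1 + (norm x)\<^sup>2) ^ CARD('d)) \<partial>count_space (lattice \<delta> :: (real ^ 'd) set)) < \<infinity>"
    by (intro le_less_trans[OF nn_integral_mono fin] ennreal_leI) simp
  then show ?thesis
    by (simp add: nn_integral_lattice_measure ennreal_mult_less_top)
qed

lemma one_plus_norm_pos: "0 < (1 + (norm x)\<^sup>2) ^ N"
  by (simp add: add_pos_nonneg)

lemma one_plus_norm_mono: "M \<le> N \<Longrightarrow> (1 + (norm x)\<^sup>2) ^ M \<le> (1 + (norm x)\<^sup>2) ^ N"
  by (rule power_increasing) simp_all

text \<open>Of the \<open>Suc CARD('d)\<close> factors one is spent on the time integral of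
  \<open>1 / (1 + t^2)\<close> and the other \<open>CARD('d)\<close> on the lattice sum; the norm of
  \<open>(t, x)\<close> dominates those of \<open>t\<close> and \<open>x\<close>.\<close>

lemma nn_integral_Gam_weight:
  assumes "\<delta> > 0"
  shows "(\<integral>\<^sup>+z. ennreal (1 / (1 + (norm z)\<^sup>2) ^ Suc CARD('d)) \<partial>(Gam_measure \<delta> :: (real \<times> (real ^ 'd)) measure)) < \<infinity>"
proof -
  let ?L = "lattice_measure \<delta> :: (real ^ 'd) measure"
  interpret L: sigma_finite_measure ?L
    by (rule sigma_finite_lattice_measure)
  let ?T = "\<integral>\<^sup>+t. ennreal (inverse (1 + t\<^sup>2)) \<partial>lborel"
  let ?X = "\<integral>\<^sup>+x. ennreal (1 / (1 + (norm x)\<^sup>2) ^ CARD('d)) \<partial>?L"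
  have "integrable lborel (\<lambda>t :: real. inverse (1 + t\<^sup>2))"
    using integrable_inverse_1_plus_square by (simp add: set_integrable_def)
  then have T: "?T < \<infinity>"
    by (simp add: integrable_iff_bounded)
  have meas: "(\<lambda>z. ennreal (1 / (1 + (norm z)\<^sup>2) ^ Suc CARD('d))) \<in> borel_measurable (Gam_measure \<delta> :: (real \<times> (real ^ 'd)) measure)"
    by (intro measurable_compose[OF borel_measurable_Gam_measure measurable_ennreal]) measurable
  have "(\<integral>\<^sup>+z. ennreal (1 / (1 + (norm z)\<^sup>2) ^ Suc CARD('d)) \<partial>(Gam_measure \<delta> :: (real \<times> (real ^ 'd)) measure))
      = (\<integral>\<^sup>+t. \<integral>\<^sup>+x. ennreal (1 / (1 + (norm (t, x))\<^sup>2) ^ Suc CARD('d)) \<partial>?L \<partial>(lborel :: real measure))"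
    unfolding Gam_measure_def
    by (rule L.nn_integral_fst[symmetric, OF meas[unfolded Gam_measure_def]])
  also have "\<dots> \<le> (\<integral>\<^sup>+t. \<integral>\<^sup>+x. ennreal (inverse (1 + t\<^sup>2)) * ennreal (1 / (1 + (norm x)\<^sup>2) ^ CARD('d)) \<partial>?L \<partial>(lborel :: real measure))"
  proof (intro nn_integral_mono)
    fix t :: real and x :: "real ^ 'd"
    have sq: "(norm (t, x))\<^sup>2 = t\<^sup>2 + (norm x)\<^sup>2"
      by (simp add: norm_Pair)
    have "(1 + t\<^sup>2) * (1 + (norm x)\<^sup>2) ^ CARD('d) \<le> (1 + (norm (t, x))\<^sup>2) * (1 + (norm (t, x))\<^sup>2) ^ CARD('d)"
      unfolding sq by (intro mult_mono power_mono) auto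
    then have "1 / (1 + (norm (t, x))\<^sup>2) ^ Suc CARD('d) \<le> 1 / ((1 + t\<^sup>2) * (1 + (norm x)\<^sup>2) ^ CARD('d))"
      unfolding power_Suc
      by (intro divide_left_mono mult_pos_pos one_plus_norm_pos one_plus_norm_pos[of _ 1, simplified]) (auto simp: add_pos_nonneg)
    also have "\<dots> = inverse (1 + t\<^sup>2) * (1 / (1 + (norm x)\<^sup>2) ^ CARD('d))"
      by (simp add: divide_simps)
    finally show "ennreal (1 / (1 + (norm (t, x))\<^sup>2) ^ Suc CARD('d))
        \<le> ennreal (inverse (1 + t\<^sup>2)) * ennreal (1 / (1 + (norm x)\<^sup>2) ^ CARD('d))"
      by (subst ennreal_mult[symmetric]) (auto intro!: ennreal_leI)
  qed
  also have "\<dots> = ?T * ?X"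
  proof -
    have "(\<integral>\<^sup>+x. ennreal (inverse (1 + t\<^sup>2)) * ennreal (1 / (1 + (norm x)\<^sup>2) ^ CARD('d)) \<partial>?L) =
        ennreal (inverse (1 + t\<^sup>2)) * ?X" for t :: real
      by (rule nn_integral_cmult) (rule measurableI; simp)
    then show ?thesis
      by (simp add: nn_integral_multc)
  qed
  also have "\<dots> < \<infinity>"
    using T nn_integral_lattice_weight[OF assms, where 'd = 'd] by (simp add: ennreal_mult_less_top)
  finally show ?thesis .
qed

section \<open>Closure properties of \<open>Mb\<close>\<close>

lemma Mb_measurable: "g \<in> Mb \<delta> \<Longrightarrow> g \<in> borel_measurable (Gam_measure \<delta>)"
  by (simp add: Mb_def)

lemma Mb_cong:
  assumes "\<And>x. x \<in> Gam \<delta> \<Longrightarrow> g x = h x"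
  shows "g \<in> Mb \<delta> \<longleftrightarrow> h \<in> Mb \<delta>"
proof -
  have "g \<in> borel_measurable (Gam_measure \<delta>) \<longleftrightarrow> h \<in> borel_measurable (Gam_measure \<delta>)"
    by (rule measurable_cong) (simp add: assms space_Gam_measure)
  moreover have "(\<integral>\<^sup>+x. ennreal (\<bar>g x\<bar> ^ k / (1 + (norm x)\<^sup>2) ^ N) \<partial>Gam_measure \<delta>) =
      (\<integral>\<^sup>+x. ennreal (\<bar>h x\<bar> ^ k / (1 + (norm x)\<^sup>2) ^ N) \<partial>Gam_measure \<delta>)" for k N
    by (rule nn_integral_cong) (simp add: assms space_Gam_measure)
  ultimately show ?thesis
    by (simp add: Mb_def)
qed

lemma Mb_polynomial_growth:
  fixes g :: "real \<times> (real ^ 'd) \<Rightarrow> real"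
  assumes "\<delta> > 0" and g: "g \<in> borel_measurable (Gam_measure \<delta>)"
    and bound: "\<And>x. x \<in> Gam \<delta> \<Longrightarrow> \<bar>g x\<bar> \<le> C * (1 + (norm x)\<^sup>2) ^ N"
  shows "g \<in> Mb \<delta>"
proof -
  \<comment> \<open>The part \<open>N * k\<close> of the exponent absorbs the growth of the
    \<open>k\<close>-th power, and the rest is the integrable weight.\<close>
  have "(\<integral>\<^sup>+x. ennreal (\<bar>g x\<bar> ^ k / (1 + (norm x)\<^sup>2) ^ (N * k + Suc CARD('d))) \<partial>Gam_measure \<delta>) < \<infinity>" for k
  proof -
    have "(\<integral>\<^sup>+x. ennreal (\<bar>g x\<bar> ^ k / (1 + (norm x)\<^sup>2) ^ (N * k + Suc CARD('d))) \<partial>Gam_measure \<delta>)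
        \<le> (\<integral>\<^sup>+x. ennreal (\<bar>C\<bar> ^ k) * ennreal (1 / (1 + (norm x)\<^sup>2) ^ Suc CARD('d)) \<partial>(Gam_measure \<delta> :: (real \<times> (real ^ 'd)) measure))"
    proof (rule nn_integral_mono)
      fix x :: "real \<times> (real ^ 'd)" assume "x \<in> space (Gam_measure \<delta>)"
      then have "\<bar>g x\<bar> \<le> C * (1 + (norm x)\<^sup>2) ^ N"
        using bound by (simp add: space_Gam_measure)
      also have "\<dots> \<le> \<bar>C\<bar> * (1 + (norm x)\<^sup>2) ^ N"
        using one_plus_norm_pos[of x N] by (intro mult_right_mono) auto
      finally have "\<bar>g x\<bar> ^ k \<le> (\<bar>C\<bar> * (1 + (norm x)\<^sup>2) ^ N) ^ k"
        by (rule power_mono) simp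
      then have "\<bar>g x\<bar> ^ k \<le> \<bar>C\<bar> ^ k * (1 + (norm x)\<^sup>2) ^ (N * k)"
        by (simp add: power_mult_distrib power_mult)
      then have "\<bar>g x\<bar> ^ k / (1 + (norm x)\<^sup>2) ^ (N * k + Suc CARD('d)) \<le>
          \<bar>C\<bar> ^ k * (1 + (norm x)\<^sup>2) ^ (N * k) / (1 + (norm x)\<^sup>2) ^ (N * k + Suc CARD('d))"
        using one_plus_norm_pos[of x "N * k + Suc CARD('d)"] by (intro divide_right_mono) auto
      also have "\<dots> = \<bar>C\<bar> ^ k * (1 / (1 + (norm x)\<^sup>2) ^ Suc CARD('d))"
        using one_plus_norm_pos[of x "N * k"] unfolding power_add by simp
      finally show "ennreal (\<bar>g x\<bar> ^ k / (1 + (norm x)\<^sup>2) ^ (N * k + Suc CARD('d))) \<le>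
          ennreal (\<bar>C\<bar> ^ k) * ennreal (1 / (1 + (norm x)\<^sup>2) ^ Suc CARD('d))"
        using one_plus_norm_pos[of x "Suc CARD('d)"]
        by (subst ennreal_mult[symmetric]) (auto intro!: ennreal_leI simp del: power_Suc)
    qed
    also have "\<dots> = ennreal (\<bar>C\<bar> ^ k) * (\<integral>\<^sup>+x. ennreal (1 / (1 + (norm x)\<^sup>2) ^ Suc CARD('d)) \<partial>(Gam_measure \<delta> :: (real \<times> (real ^ 'd)) measure))"
      by (intro nn_integral_cmult measurable_compose[OF borel_measurable_Gam_measure measurable_ennreal]) measurable
    also have "\<dots> < \<infinity>"
      using nn_integral_Gam_weight[OF assms(1), where 'd = 'd] by (simp add: ennreal_mult_less_top)
    finally show ?thesis .
  qed
  then show ?thesis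
    using g unfolding Mb_def by blast
qed

lemma Mb_const: "\<delta> > 0 \<Longrightarrow> (\<lambda>_. c) \<in> Mb \<delta>"
  by (rule Mb_polynomial_growth[where C = "\<bar>c\<bar>" and N = 0]) simp_all

text \<open>Common core of sums and products. The exponent \<open>l\<close> may depend on
  \<open>k\<close>, as products need higher moments of the factors; of the two weights that come
  with \<open>g\<close> and \<open>h\<close> the stronger one serves for both.\<close>

lemma Mb_dominated:
  assumes g: "g \<in> Mb \<delta>" and h: "h \<in> Mb \<delta>" and u: "u \<in> borel_measurable (Gam_measure \<delta>)"
    and bound: "\<And>k. \<exists>c l. c \<ge> 0 \<and> (\<forall>x\<in>Gam \<delta>. \<bar>u x\<bar> ^ k \<le> c * (\<bar>g x\<bar> ^ l + \<bar>h x\<bar> ^ l))"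
  shows "u \<in> Mb \<delta>"
proof -
  have "\<exists>N. (\<integral>\<^sup>+x. ennreal (\<bar>u x\<bar> ^ k / (1 + (norm x)\<^sup>2) ^ N) \<partial>Gam_measure \<delta>) < \<infinity>" for k
  proof -
    obtain c l where c: "c \<ge> 0" and le: "\<And>x. x \<in> Gam \<delta> \<Longrightarrow> \<bar>u x\<bar> ^ k \<le> c * (\<bar>g x\<bar> ^ l + \<bar>h x\<bar> ^ l)"
      using bound by blast
    obtain A B where A: "(\<integral>\<^sup>+x. ennreal (\<bar>g x\<bar> ^ l / (1 + (norm x)\<^sup>2) ^ A) \<partial>Gam_measure \<delta>) < \<infinity>"
      and B: "(\<integral>\<^sup>+x. ennreal (\<bar>h x\<bar> ^ l / (1 + (norm x)\<^sup>2) ^ B) \<partial>Gam_measure \<delta>) < \<infinity>"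
      using g h unfolding Mb_def by blast
    have meas: "(\<lambda>x. ennreal (\<bar>v x\<bar> ^ l / (1 + (norm x)\<^sup>2) ^ n)) \<in> borel_measurable (Gam_measure \<delta>)"
      if "v \<in> borel_measurable (Gam_measure \<delta>)" for v :: "real \<times> (real ^ 'a) \<Rightarrow> real" and n
    proof -
      have [measurable]: "(\<lambda>x. 1 / (1 + (norm x)\<^sup>2) ^ n) \<in> borel_measurable (Gam_measure \<delta> :: (real \<times> (real ^ 'a)) measure)"
        by (rule borel_measurable_Gam_measure) measurable
      note that[measurable]
      have "(\<lambda>x. ennreal (\<bar>v x\<bar> ^ l * (1 / (1 + (norm x)\<^sup>2) ^ n))) \<in> borel_measurable (Gam_measure \<delta>)"
        by measurable
      then show ?thesis
        by simp
    qed
    have "(\<integral>\<^sup>+x. ennreal (\<bar>u x\<bar> ^ k / (1 + (norm x)\<^sup>2) ^ max A B) \<partial>Gam_measure \<delta>) \<le>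
        (\<integral>\<^sup>+x. ennreal c * (ennreal (\<bar>g x\<bar> ^ l / (1 + (norm x)\<^sup>2) ^ A) + ennreal (\<bar>h x\<bar> ^ l / (1 + (norm x)\<^sup>2) ^ B)) \<partial>Gam_measure \<delta>)"
    proof (rule nn_integral_mono)
      fix x :: "real \<times> (real ^ 'a)" assume "x \<in> space (Gam_measure \<delta>)"
      then have "\<bar>u x\<bar> ^ k / (1 + (norm x)\<^sup>2) ^ max A B \<le> c * (\<bar>g x\<bar> ^ l + \<bar>h x\<bar> ^ l) / (1 + (norm x)\<^sup>2) ^ max A B"
        using le one_plus_norm_pos[of x "max A B"] by (intro divide_right_mono) (auto simp: space_Gam_measure)
      also have "\<dots> = c * (\<bar>g x\<bar> ^ l / (1 + (norm x)\<^sup>2) ^ max A B + \<bar>h x\<bar> ^ l / (1 + (norm x)\<^sup>2) ^ max A B)"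
        by (simp add: add_divide_distrib distrib_left)
      also have "\<dots> \<le> c * (\<bar>g x\<bar> ^ l / (1 + (norm x)\<^sup>2) ^ A + \<bar>h x\<bar> ^ l / (1 + (norm x)\<^sup>2) ^ B)"
        using c one_plus_norm_pos[of x]
        by (intro mult_left_mono add_mono divide_left_mono one_plus_norm_mono mult_pos_pos) auto
      finally show "ennreal (\<bar>u x\<bar> ^ k / (1 + (norm x)\<^sup>2) ^ max A B) \<le>
          ennreal c * (ennreal (\<bar>g x\<bar> ^ l / (1 + (norm x)\<^sup>2) ^ A) + ennreal (\<bar>h x\<bar> ^ l / (1 + (norm x)\<^sup>2) ^ B))"
        using c by (simp add: ennreal_leI flip: ennreal_plus ennreal_mult)
    qed
    also have "\<dots> = ennreal c * ((\<integral>\<^sup>+x. ennreal (\<bar>g x\<bar> ^ l / (1 + (norm x)\<^sup>2) ^ A) \<partial>Gam_measure \<delta>) +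
        (\<integral>\<^sup>+x. ennreal (\<bar>h x\<bar> ^ l / (1 + (norm x)\<^sup>2) ^ B) \<partial>Gam_measure \<delta>))"
      using meas[OF Mb_measurable[OF g]] meas[OF Mb_measurable[OF h]]
      by (subst nn_integral_cmult) (simp_all add: nn_integral_add borel_measurable_add)
    also have "\<dots> < \<infinity>"
      using A B by (simp add: ennreal_mult_less_top)
    finally show ?thesis by blast
  qed
  then show ?thesis
    using u by (simp add: Mb_def)
qed

lemma Mb_add:
  assumes "g \<in> Mb \<delta>" and "h \<in> Mb \<delta>"
  shows "(\<lambda>x. g x + h x) \<in> Mb \<delta>"
proof (rule Mb_dominated[OF assms])
  show "(\<lambda>x. g x + h x) \<in> borel_measurable (Gam_measure \<delta>)"
    using assms by (intro borel_measurable_add Mb_measurable)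
  show "\<exists>c l. c \<ge> 0 \<and> (\<forall>x\<in>Gam \<delta>. \<bar>g x + h x\<bar> ^ k \<le> c * (\<bar>g x\<bar> ^ l + \<bar>h x\<bar> ^ l))" for k
  proof (intro exI conjI ballI)
    fix x
    have "\<bar>g x + h x\<bar> ^ k \<le> (2 * max \<bar>g x\<bar> \<bar>h x\<bar>) ^ k"
      by (intro power_mono) auto
    also have "\<dots> \<le> 2 ^ k * (\<bar>g x\<bar> ^ k + \<bar>h x\<bar> ^ k)"
      unfolding power_mult_distrib by (intro mult_left_mono) (auto simp: max_def)
    finally show "\<bar>g x + h x\<bar> ^ k \<le> 2 ^ k * (\<bar>g x\<bar> ^ k + \<bar>h x\<bar> ^ k)" .
  qed simp
qed

lemma Mb_mult:
  assumes "g \<in> Mb \<delta>" and "h \<in> Mb \<delta>"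
  shows "(\<lambda>x. g x * h x) \<in> Mb \<delta>"
proof (rule Mb_dominated[OF assms])
  show "(\<lambda>x. g x * h x) \<in> borel_measurable (Gam_measure \<delta>)"
    using assms by (intro borel_measurable_times Mb_measurable)
  show "\<exists>c l. c \<ge> 0 \<and> (\<forall>x\<in>Gam \<delta>. \<bar>g x * h x\<bar> ^ k \<le> c * (\<bar>g x\<bar> ^ l + \<bar>h x\<bar> ^ l))" for k
  proof (intro exI conjI ballI)
    fix x
    \<comment> \<open>The \<open>k\<close>-th moment of the product is controlled by the moments of
      order \<open>2 * k\<close> of the factors.\<close>
    have "\<bar>g x\<bar> ^ k * \<bar>h x\<bar> ^ k \<le> (\<bar>g x\<bar> ^ k)\<^sup>2 + (\<bar>h x\<bar> ^ k)\<^sup>2"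
      using sum_squares_bound[of "\<bar>g x\<bar> ^ k" "\<bar>h x\<bar> ^ k"] by (simp add: mult.assoc) (smt (verit) zero_le_power abs_ge_zero mult_nonneg_nonneg)
    then show "\<bar>g x * h x\<bar> ^ k \<le> 1 * (\<bar>g x\<bar> ^ (k * 2) + \<bar>h x\<bar> ^ (k * 2))"
      by (simp add: abs_mult power_mult_distrib power_mult)
  qed simp
qed

lemma Mb_power:
  assumes "\<delta> > 0" and "g \<in> Mb \<delta>"
  shows "(\<lambda>x. g x ^ n) \<in> Mb \<delta>"
  by (induction n) (simp_all add: assms Mb_const Mb_mult)

lemma Mb_sum:
  assumes "\<delta> > 0" and "\<And>i. i \<in> I \<Longrightarrow> g i \<in> Mb \<delta>"
  shows "(\<lambda>x. \<Sum>i\<in>I. g i x) \<in> Mb \<delta>"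
  \<comment> \<open>For infinite \<open>I\<close> the sum is 0 by convention, again a constant
    function in \<open>Mb\<close>.\<close>
  using assms(2) by (induction I rule: infinite_finite_induct) (simp_all add: assms(1) Mb_const Mb_add)

lemma Mb_prod:
  assumes "\<delta> > 0" and "\<And>i. i \<in> I \<Longrightarrow> g i \<in> Mb \<delta>"
  shows "(\<lambda>x. \<Prod>i\<in>I. g i x) \<in> Mb \<delta>"
  using assms(2) by (induction I rule: infinite_finite_induct) (simp_all add: assms(1) Mb_const Mb_mult)

section \<open>Fourier integrals over the Brillouin zone\<close>

text \<open>Fubini in coordinates: \<open>lborel\<close> is the image of a product of
  one-dimensional Lebesgue measures under the map that assembles a vector from its
  coordinates.\<close>

lemma lborel_integral_prod:
  fixes h :: "'a :: euclidean_space \<Rightarrow> real \<Rightarrow> complex"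
  assumes int: "\<And>b. b \<in> Basis \<Longrightarrow> integrable lborel (h b)"
  shows "(\<integral>p. (\<Prod>b\<in>Basis. h b (p \<bullet> b)) \<partial>(lborel :: 'a measure)) = (\<Prod>b\<in>Basis. \<integral>s. h b s \<partial>lborel)"
proof -
  interpret product_sigma_finite "\<lambda>_ :: 'a. lborel :: real measure" ..
  have [measurable]: "h b \<in> borel_measurable borel" if "b \<in> Basis" for b
    using borel_measurable_integrable[OF int[OF that]] by simp
  have "(\<integral>p. (\<Prod>b\<in>Basis. h b (p \<bullet> b)) \<partial>(lborel :: 'a measure)) =
      (\<integral>f. (\<Prod>b\<in>Basis. h b ((\<Sum>c\<in>Basis. f c *\<^sub>R c) \<bullet> b)) \<partial>(\<Pi>\<^sub>M b\<in>(Basis :: 'a set). (lborel :: real measure)))"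
    unfolding lborel_eq[where 'a = 'a] by (rule integral_distr) measurable
  also have "\<dots> = (\<integral>f. (\<Prod>b\<in>Basis. h b (f b)) \<partial>(\<Pi>\<^sub>M b\<in>(Basis :: 'a set). (lborel :: real measure)))"
    by (intro Bochner_Integration.integral_cong prod.cong refl) (simp add: inner_sum_left inner_Basis if_distrib cong: if_cong)
  also have "\<dots> = (\<Prod>b\<in>Basis. \<integral>s. h b s \<partial>lborel)"
    by (rule product_integral_prod) (simp_all add: int)
  finally show ?thesis .
qed

lemma set_integrable_continuous_cbox:
  fixes F :: "'a :: euclidean_space \<Rightarrow> 'b :: {banach, second_countable_topology}"
  assumes "continuous_on UNIV F"
  shows "set_integrable lborel (cbox a b) F"
  unfolding set_integrable_def
  using assms by (intro borel_integrable_compact compact_cbox) (rule continuous_on_subset, auto)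

section \<open>Lattice characters and their integrals against powers of the cosine sum\<close>

definition character :: "real \<Rightarrow> int ^ 'd \<Rightarrow> real ^ 'd \<Rightarrow> complex" where
  "character \<delta> m p = exp (- \<i> * of_real (p \<bullet> (\<chi> i. \<delta> * of_int (m $ i))))"

lemma norm_character [simp]: "norm (character \<delta> m p) = 1"
  by (simp add: character_def)

lemma continuous_on_character: "continuous_on A (character \<delta> m)"
  unfolding character_def by (intro continuous_intros)

text \<open>Writing the cosine as half the sum of two exponentials turns multiplication by it into
  one random walk step in direction \<open>j\<close>, in frequency space.\<close>

lemma character_mult_cos:
  "character \<delta> m p * of_real (cos (\<delta> * p $ j)) =
     (1/2) * (character \<delta> (m + axis j 1) p + character \<delta> (m - axis j 1) p)"
proof -
  have shift: "character \<delta> (m + axis j c) p = character \<delta> m p * exp (- \<i> * of_int c * of_real (\<delta> * p $ j))" for c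
  proof -
    have "(\<chi> i. \<delta> * of_int ((m + axis j c) $ i)) = (\<chi> i. \<delta> * of_int (m $ i)) + of_int c *\<^sub>R axis j \<delta>"
      by (simp add: vec_eq_iff axis_def distrib_left)
    then show ?thesis
      unfolding character_def mult_exp_exp
      by (simp add: inner_add_right inner_axis distrib_left mult_ac)
  qed
  have minus: "m - axis j 1 = m + axis j (- 1)"
    by (simp add: vec_eq_iff axis_def)
  have cos: "of_real (cos (\<delta> * p $ j)) = (exp (\<i> * of_real (\<delta> * p $ j)) + exp (- \<i> * of_real (\<delta> * p $ j))) / 2"
    unfolding cos_of_real[symmetric] cos_exp_eq by simp
  show ?thesis
    unfolding minus cos shift by (simp add: distrib_left add.commute)
qed

text \<open>The integral factorizes over the coordinates, with one-dimensional factors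
  \<open>h b\<close>. In direction \<open>k\<close> the factor is an exponential integrated over a
  nonzero whole number of periods, which gives 0.\<close>

lemma integral_character:
  fixes m :: "int ^ 'd"
  assumes "\<delta> > 0" and "m $ k \<noteq> 0"
  shows "(CLINT p : cbox 0 (\<chi> i. 2 * pi / \<delta>) | lborel. character \<delta> m p) = 0"
proof -
  define h :: "real ^ 'd \<Rightarrow> real \<Rightarrow> complex" where
    "h = (\<lambda>b s. indicator (cbox 0 (2 * pi / \<delta>)) s *\<^sub>R exp (- \<i> * of_real (s * ((\<chi> i. \<delta> * of_int (m $ i)) \<bullet> b))))"
  have "indicator (cbox 0 (\<chi> i. 2 * pi / \<delta>)) p *\<^sub>R character \<delta> m p = (\<Prod>b\<in>Basis. h b (p \<bullet> b))" for p :: "real ^ 'd"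
  proof -
    have "indicat_real (cbox 0 (\<chi> i. 2 * pi / \<delta>)) p = (\<Prod>b\<in>Basis. indicat_real (cbox 0 (2 * pi / \<delta>)) (p \<bullet> b))"
    proof -
      have "(\<chi> i. 2 * pi / \<delta>) \<bullet> b = 2 * pi / \<delta>" if "b \<in> Basis" for b :: "real ^ 'd"
        using that by (auto simp: Basis_vec_def inner_axis)
      then show ?thesis
        by (auto simp: indicator_def mem_box prod_zero_iff)
    qed
    moreover have "character \<delta> m p = (\<Prod>b\<in>Basis. exp (- \<i> * of_real ((p \<bullet> b) * ((\<chi> i. \<delta> * of_int (m $ i)) \<bullet> b))))"
      unfolding character_def
      by (subst euclidean_inner) (simp add: exp_sum[symmetric] sum_distrib_left sum_negf)
    ultimately show ?thesis
      unfolding h_def by (simp add: scaleR_conv_of_real prod.distrib)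
  qed
  moreover have int_h: "integrable lborel (h b)" for b
    unfolding h_def
    by (intro set_integrable_continuous_cbox[unfolded set_integrable_def] continuous_intros)
  ultimately have "(CLINT p : cbox 0 (\<chi> i. 2 * pi / \<delta>) | lborel. character \<delta> m p) = (\<Prod>b\<in>Basis. \<integral>s. h b s \<partial>lborel)"
    unfolding set_lebesgue_integral_def using lborel_integral_prod[OF int_h] by simp
  also have "\<dots> = 0"
  proof (rule prod_zero)
    let ?c = "\<delta> * of_int (m $ k)"
    have c: "?c \<noteq> 0"
      using assms by simp
    define c' where "c' = - \<i> * of_real ?c"
    have c': "c' \<noteq> 0"
      using c by (simp add: c'_def)
    have "(\<integral>s. h (axis k 1) s \<partial>lborel) = (\<integral>s. indicator {0..2 * pi / \<delta>} s *\<^sub>R exp (c' * of_real s) \<partial>lborel)"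
    proof (rule Bochner_Integration.integral_cong)
      fix s
      have "- \<i> * of_real (s * ((\<chi> i. \<delta> * of_int (m $ i)) \<bullet> axis k 1)) = c' * of_real s"
        by (simp add: inner_axis c'_def)
      then show "h (axis k 1) s = indicator {0..2 * pi / \<delta>} s *\<^sub>R exp (c' * of_real s)"
        unfolding h_def by simp
    qed simp
    also have "\<dots> = exp (c' * of_real (2 * pi / \<delta>)) / c' - exp (c' * of_real 0) / c'"
    proof (rule integral_FTC_atLeastAtMost)
      fix s
      have "((\<lambda>z. exp (c' * z) / c') has_field_derivative exp (c' * of_real s)) (at (of_real s))"
        using c' by (auto intro!: derivative_eq_intros)
      then show "((\<lambda>s. exp (c' * of_real s) / c') has_vector_derivative exp (c' * of_real s)) (at s within {0..2 * pi / \<delta>})"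
        by (rule has_vector_derivative_real_field)
    qed (use assms in \<open>auto intro!: continuous_intros\<close>)
    also have "exp (c' * of_real (2 * pi / \<delta>)) = 1"
    proof -
      have "c' * of_real (2 * pi / \<delta>) = - \<i> * of_real (2 * pi * of_int (m $ k))"
        using assms by (simp add: c'_def field_simps)
      then have "Re (c' * of_real (2 * pi / \<delta>)) = 0"
        and "Im (c' * of_real (2 * pi / \<delta>)) = of_int (2 * - (m $ k)) * pi"
        by simp_all
      then show ?thesis
        unfolding exp_eq_1 by blast
    qed
    finally have "(\<integral>s. h (axis k 1) s \<partial>lborel) = 0"
      by simp
    moreover have "axis k 1 \<in> (Basis :: (real ^ 'd) set)"
      by (simp add: axis_in_Basis_iff)
    ultimately show "\<exists>b\<in>Basis. (\<integral>s. h b s \<partial>lborel) = 0"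
      by blast
  qed simp
  finally show ?thesis .
qed

definition cos_sum :: "real \<Rightarrow> real ^ 'd \<Rightarrow> real" where
  "cos_sum \<delta> p = (\<Sum>j\<in>UNIV. cos (\<delta> * p $ j))"

lemma continuous_on_cos_sum: "continuous_on A (cos_sum \<delta>)"
  unfolding cos_sum_def by (intro continuous_intros)

lemma abs_cos_sum_le: "\<bar>cos_sum \<delta> (p :: real ^ 'd)\<bar> \<le> CARD('d)"
  unfolding cos_sum_def using sum_norm_le[of UNIV "\<lambda>j. cos (\<delta> * p $ j)" "\<lambda>_. 1"] by simp

text \<open>
  A product of \<open>n\<close> cosines has frequencies of size at most \<open>n\<close>: in the random walk picture the
  lattice point \<open>\<delta> m\<close> is not reached in \<open>n\<close> steps.
\<close>

lemma integral_character_cos_sum_power: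
  fixes m :: "int ^ 'd"
  assumes "\<delta> > 0" and "int n < \<bar>m $ k\<bar>"
  shows "(CLINT p : cbox 0 (\<chi> i. 2 * pi / \<delta>) | lborel. character \<delta> m p * of_real (cos_sum \<delta> p ^ n)) = 0"
  using assms(2)
proof (induction n arbitrary: m)
  case 0
  then show ?case
    using integral_character[OF assms(1)] by simp
next
  case (Suc n)
  let ?B = "cbox 0 (\<chi> i. 2 * pi / \<delta>) :: (real ^ 'd) set"
  let ?F = "\<lambda>m p. character \<delta> m p * of_real (cos_sum \<delta> p ^ n)"
  have int: "set_integrable lborel ?B (?F m)" for m
    by (intro set_integrable_continuous_cbox continuous_intros continuous_on_character continuous_on_cos_sum)
  have int_half: "set_integrable lborel ?B (\<lambda>p. (1/2) * (?F (m + axis j 1) p + ?F (m - axis j 1) p))" for j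
    using int by (intro set_integrable_mult_right set_integral_add)
  have "character \<delta> m p * of_real (cos_sum \<delta> p ^ Suc n) =
      (\<Sum>j\<in>UNIV. (1/2) * (?F (m + axis j 1) p + ?F (m - axis j 1) p))" for p
  proof -
    have "character \<delta> m p * of_real (cos_sum \<delta> p ^ Suc n) =
        (\<Sum>j\<in>UNIV. character \<delta> m p * of_real (cos (\<delta> * p $ j)) * of_real (cos_sum \<delta> p ^ n))"
      unfolding power_Suc by (simp add: cos_sum_def sum_distrib_left sum_distrib_right mult.assoc)
    then show ?thesis
      unfolding character_mult_cos by (simp add: distrib_right mult.assoc)
  qed
  then have "(CLINT p : ?B | lborel. character \<delta> m p * of_real (cos_sum \<delta> p ^ Suc n)) =
      (\<Sum>j\<in>UNIV. CLINT p : ?B | lborel. (1/2) * (?F (m + axis j 1) p + ?F (m - axis j 1) p))"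
    using int_half unfolding set_lebesgue_integral_def set_integrable_def
    by (simp only: scaleR_sum_right) (rule Bochner_Integration.integral_sum)
  also have "\<dots> = (\<Sum>j\<in>UNIV. (1/2) * ((CLINT p : ?B | lborel. ?F (m + axis j 1) p) + (CLINT p : ?B | lborel. ?F (m - axis j 1) p)))"
    using int by (simp only: set_integral_mult_right set_integral_add)
  also have "\<dots> = 0"
  proof (intro sum.neutral ballI)
    fix j
    \<comment> \<open>One step changes the \<open>k\<close>-th coordinate by at most 1, while the
      assumption has dropped from \<open>Suc n\<close> to \<open>n\<close>.\<close>
    have "int n < \<bar>(m + axis j 1) $ k\<bar>" "int n < \<bar>(m - axis j 1) $ k\<bar>"
      using Suc.prems by (auto simp: axis_def)
    then show "(1/2) * ((CLINT p : ?B | lborel. ?F (m + axis j 1) p) + (CLINT p : ?B | lborel. ?F (m - axis j 1) p)) = 0"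
      using Suc.IH by simp
  qed
  finally show ?case .
qed

text \<open>A Chernoff-type bound: in a term of order at least \<open>N\<close> the factor
  \<open>exp a\<close> to the power (order minus \<open>N\<close>) is at least 1 and may be
  inserted. The tail is then at most \<open>exp (- a * N)\<close> times the full series of
  \<open>exp (\<bar>z\<bar> * exp a)\<close>.\<close>

lemma exp_taylor_tail_le:
  fixes z a :: real
  assumes "a \<ge> 0"
  shows "\<bar>exp z - (\<Sum>n<N. z ^ n / fact n)\<bar> \<le> exp (\<bar>z\<bar> * exp a - a * N)"
proof -
  let ?u = "\<lambda>n. (\<bar>z\<bar> * exp a) ^ n / fact n"
  have sm: "summable ?u"
    using summable_exp[of "\<bar>z\<bar> * exp a"] by (simp add: field_simps)
  have le: "norm (z ^ (n + N) / fact (n + N)) \<le> exp (- a * N) * ?u (n + N)" for n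
  proof -
    have "exp (- a * N) * exp a ^ N = 1"
      unfolding exp_of_nat_mult[symmetric] mult_exp_exp by simp
    then have "exp (- a * N) * exp a ^ (n + N) = exp a ^ n"
      by (simp only: power_add mult.left_commute[of _ "exp a ^ n"] mult_1_right)
    moreover have "1 \<le> exp a ^ n"
      using assms by simp
    ultimately have "\<bar>z\<bar> ^ (n + N) * 1 \<le> \<bar>z\<bar> ^ (n + N) * (exp (- a * N) * exp a ^ (n + N))"
      by (intro mult_left_mono) auto
    then have "\<bar>z\<bar> ^ (n + N) \<le> exp (- a * N) * (\<bar>z\<bar> * exp a) ^ (n + N)"
      by (simp add: power_mult_distrib mult.left_commute mult.assoc)
    then have "\<bar>z\<bar> ^ (n + N) / fact (n + N) \<le> exp (- a * N) * (\<bar>z\<bar> * exp a) ^ (n + N) / fact (n + N)"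
      by (rule divide_right_mono) simp
    then show ?thesis
      by (simp add: power_abs)
  qed
  have smN: "summable (\<lambda>n. ?u (n + N))"
    using sm by (rule summable_ignore_initial_segment)
  have "exp z - (\<Sum>n<N. z ^ n / fact n) = (\<Sum>n. z ^ (n + N) / fact (n + N))"
    using exp_first_terms[of z N] by (simp add: divide_inverse mult.commute)
  also have "\<bar>\<dots>\<bar> \<le> (\<Sum>n. exp (- a * N) * ?u (n + N))"
    using norm_suminf_le[OF le summable_mult[OF smN]] by simp
  also have "\<dots> = exp (- a * N) * (\<Sum>n. ?u (n + N))"
    by (rule suminf_mult[OF smN])
  also have "\<dots> \<le> exp (- a * N) * (\<Sum>n. ?u n)"
    using suminf_minus_initial_segment[OF sm, of N] by (intro mult_left_mono) (simp_all add: sum_nonneg)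
  also have "(\<Sum>n. ?u n) = exp (\<bar>z\<bar> * exp a)"
    by (simp add: exp_def divide_inverse mult.commute)
  finally show ?thesis
    unfolding mult_exp_exp by (simp add: add.commute)
qed

section \<open>Decay of the Green function\<close>

text \<open>
  The Taylor polynomial of the exponential of degree below \<open>\<bar>m $ k\<bar>\<close> integrates to \<open>0\<close> against the
  character, so only the Taylor tail contributes.
\<close>

lemma norm_heat_kernel_complex_le:
  fixes m :: "int ^ 'd" and \<delta> m0 t a :: real
  assumes "\<delta> > 0" and "t \<ge> 0" and "a \<ge> 0"
  shows "norm (heat_kernel_complex \<delta> m0 t (\<chi> i. \<delta> * of_int (m $ i))) \<le>
    exp (2 * real CARD('d) / \<delta>\<^sup>2 * t * (exp a - 1) - m0\<^sup>2 * t - a * \<bar>m $ k\<bar>) / \<delta> ^ CARD('d)"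
proof -
  let ?B = "cbox 0 (\<chi> i. 2 * pi / \<delta>) :: (real ^ 'd) set"
  let ?d = "real CARD('d)"
  \<comment> \<open>\<open>K\<close> and \<open>\<tau>\<close> come from splitting
    \<open>exp (- t * mu2 \<delta> m0 p)\<close> into a constant and
    \<open>exp (\<tau> * cos_sum \<delta> p)\<close>. \<open>P\<close> collects the Taylor terms
    that integrate to 0, and \<open>E\<close> bounds the remainder uniformly in
    \<open>p\<close>.\<close>
  define \<tau> where "\<tau> = 2 / \<delta>\<^sup>2 * t"
  define N where "N = nat \<bar>m $ k\<bar>"
  define K where "K = exp (- t * (2 / \<delta>\<^sup>2 * ?d + m0\<^sup>2))"
  define P where "P = (\<lambda>p :: real ^ 'd. \<Sum>n<N. (\<tau> * cos_sum \<delta> p) ^ n / fact n)"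
  define E where "E = exp (\<tau> * ?d * exp a - a * N)"
  have \<tau>: "\<tau> \<ge> 0"
    using assms by (simp add: \<tau>_def)
  have int_char: "set_integrable lborel ?B (\<lambda>p. character \<delta> m p * of_real (u p))" if "continuous_on UNIV u" for u
    using that by (intro set_integrable_continuous_cbox continuous_intros continuous_on_character)
  have cont_P: "continuous_on UNIV P"
    unfolding P_def by (intro continuous_intros continuous_on_cos_sum) auto
  have cont_exp: "continuous_on UNIV (\<lambda>p :: real ^ 'd. exp (\<tau> * cos_sum \<delta> p))"
    by (intro continuous_intros continuous_on_cos_sum)
  have P0: "(CLINT p : ?B | lborel. character \<delta> m p * of_real (P p)) = 0"
  proof -
    have "(CLINT p : ?B | lborel. character \<delta> m p * of_real (P p)) =
        (CLINT p : ?B | lborel. (\<Sum>n<N. of_real (\<tau> ^ n / fact n) * (character \<delta> m p * of_real (cos_sum \<delta> p ^ n))))"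
      by (simp add: P_def sum_distrib_left power_mult_distrib mult_ac)
    also have "\<dots> = (\<Sum>n<N. CLINT p : ?B | lborel. of_real (\<tau> ^ n / fact n) * (character \<delta> m p * of_real (cos_sum \<delta> p ^ n)))"
    proof -
      have "set_integrable lborel ?B (\<lambda>p. of_real (\<tau> ^ n / fact n) * (character \<delta> m p * of_real (cos_sum \<delta> p ^ n)))" for n
        by (intro set_integrable_mult_right int_char continuous_intros continuous_on_cos_sum)
      then show ?thesis
        unfolding set_lebesgue_integral_def set_integrable_def scaleR_sum_right
        by (intro Bochner_Integration.integral_sum)
    qed
    also have "\<dots> = 0"
    proof (intro sum.neutral ballI)
      fix n assume "n \<in> {..<N}"
      then have "int n < \<bar>m $ k\<bar>"
        by (auto simp: N_def)
      then show "(CLINT p : ?B | lborel. of_real (\<tau> ^ n / fact n) * (character \<delta> m p * of_real (cos_sum \<delta> p ^ n))) = 0"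
        by (simp only: set_integral_mult_right integral_character_cos_sum_power[OF assms(1)] mult_zero_right)
    qed
    finally show ?thesis .
  qed
  have pointwise: "norm (character \<delta> m p * of_real (exp (\<tau> * cos_sum \<delta> p) - P p)) \<le> E" for p :: "real ^ 'd"
  proof -
    have "\<bar>exp (\<tau> * cos_sum \<delta> p) - P p\<bar> \<le> exp (\<bar>\<tau> * cos_sum \<delta> p\<bar> * exp a - a * N)"
      unfolding P_def by (rule exp_taylor_tail_le[OF assms(3)])
    also have "\<dots> \<le> E"
      unfolding E_def exp_le_cancel_iff abs_mult using abs_cos_sum_le[of \<delta> p] \<tau>
      by (intro diff_right_mono mult_right_mono mult_mono) auto
    finally show ?thesis
      by (simp only: norm_mult norm_character norm_of_real mult_1_left)
  qed
  have "norm (CLINT p : ?B | lborel. character \<delta> m p * of_real (exp (\<tau> * cos_sum \<delta> p))) =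
      norm (CLINT p : ?B | lborel. character \<delta> m p * of_real (exp (\<tau> * cos_sum \<delta> p) - P p))"
    using int_char[OF cont_P] int_char[OF cont_exp] P0
    by (simp only: of_real_diff right_diff_distrib set_integral_diff(2) diff_zero)
  also have "\<dots> \<le> (LINT p : ?B | lborel. norm (character \<delta> m p * of_real (exp (\<tau> * cos_sum \<delta> p) - P p)))"
    by (intro set_integral_norm_bound int_char continuous_intros cont_P cont_exp)
  also have "\<dots> \<le> (LINT p : ?B | lborel. E)"
  proof (rule set_integral_mono)
    show "set_integrable lborel ?B (\<lambda>p. norm (character \<delta> m p * of_real (exp (\<tau> * cos_sum \<delta> p) - P p)))"
      by (intro set_integrable_norm int_char continuous_intros cont_P cont_exp)
    show "set_integrable lborel ?B (\<lambda>p. E)"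
      by (intro set_integrable_continuous_cbox continuous_intros)
  qed (rule pointwise)
  also have "\<dots> = E * (2 * pi / \<delta>) ^ CARD('d)"
  proof -
    have "?B \<noteq> {}"
      using assms(1) by (auto simp: box_ne_empty Basis_vec_def inner_axis)
    then have "measure lborel ?B = (2 * pi / \<delta>) ^ CARD('d)"
      using content_cbox_cart[of "0 :: real ^ 'd" "\<chi> i. 2 * pi / \<delta>"] by simp
    then show ?thesis
      by (simp add: set_lebesgue_integral_def)
  qed
  finally have I: "norm (CLINT p : ?B | lborel. character \<delta> m p * of_real (exp (\<tau> * cos_sum \<delta> p))) \<le> E * (2 * pi / \<delta>) ^ CARD('d)" .
  have "exp (- \<i> * of_real (p \<bullet> (\<chi> i. \<delta> * of_int (m $ i)))) * of_real (exp (- t * mu2 \<delta> m0 p)) =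
      of_real K * (character \<delta> m p * of_real (exp (\<tau> * cos_sum \<delta> p)))" for p :: "real ^ 'd"
  proof -
    have "- t * mu2 \<delta> m0 p = - t * (2 / \<delta>\<^sup>2 * ?d + m0\<^sup>2) + \<tau> * cos_sum \<delta> p"
      by (simp add: mu2_def \<tau>_def cos_sum_def algebra_simps diff_divide_distrib)
    then have "exp (- t * mu2 \<delta> m0 p) = K * exp (\<tau> * cos_sum \<delta> p)"
      by (simp only: K_def exp_add)
    then show ?thesis
      by (simp only: character_def of_real_mult mult_ac)
  qed
  then have "heat_kernel_complex \<delta> m0 t (\<chi> i. \<delta> * of_int (m $ i)) = of_real (1 / (2 * pi) ^ CARD('d)) *
      (of_real K * (CLINT p : ?B | lborel. character \<delta> m p * of_real (exp (\<tau> * cos_sum \<delta> p))))"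
    unfolding heat_kernel_complex_def by (simp only: set_integral_mult_right)
  then have "norm (heat_kernel_complex \<delta> m0 t (\<chi> i. \<delta> * of_int (m $ i))) =
      1 / (2 * pi) ^ CARD('d) * (K * norm (CLINT p : ?B | lborel. character \<delta> m p * of_real (exp (\<tau> * cos_sum \<delta> p))))"
    by (simp only: norm_mult norm_of_real) (simp add: K_def)
  also have "\<dots> \<le> 1 / (2 * pi) ^ CARD('d) * (K * (E * (2 * pi / \<delta>) ^ CARD('d)))"
    using I by (intro mult_left_mono) (simp_all add: K_def)
  \<comment> \<open>The volume of the Brillouin zone cancels the normalization of the Fourier
    integral up to a power of \<open>\<delta>\<close>.\<close>
  also have "\<dots> = K * E / \<delta> ^ CARD('d)"
    by (simp add: power_divide)
  also have "K * E = exp (2 * real CARD('d) / \<delta>\<^sup>2 * t * (exp a - 1) - m0\<^sup>2 * t - a * \<bar>m $ k\<bar>)"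
    unfolding K_def E_def mult_exp_exp by (simp add: \<tau>_def N_def algebra_simps diff_divide_distrib)
  finally show ?thesis .
qed

text \<open>The kernel bound has a free parameter \<open>a\<close>: larger values improve the decay
  in space but cost growth in time, which the mass term must outweigh.\<close>

lemma green_exponential_decay:
  assumes "\<delta> > 0" and "m0 > 0"
  obtains A c where "A > 0" and "c > 0"
    and "\<And>z. z \<in> Gam \<delta> \<Longrightarrow> \<bar>green \<delta> m0 (z :: real \<times> (real ^ 'd))\<bar> \<le> A * exp (- c * norm z)"
proof
  let ?d = "real CARD('d)"
  \<comment> \<open>Chosen so that \<open>2 * ?d / \<delta>\<^sup>2 * (exp a - 1)\<close> equals
    \<open>m0\<^sup>2 / 2\<close>; half of the mass term is left for decay in time.\<close>
  define a where "a = ln (1 + m0\<^sup>2 * \<delta>\<^sup>2 / (4 * ?d))"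
  define c where "c = min (m0\<^sup>2 / 2) (a / (?d * \<delta>))"
  have pos: "m0\<^sup>2 * \<delta>\<^sup>2 / (4 * ?d) > 0"
    using assms by simp
  then have a: "a > 0"
    by (simp add: a_def)
  have exp_a: "exp a = 1 + m0\<^sup>2 * \<delta>\<^sup>2 / (4 * ?d)"
    using pos by (simp add: a_def)
  have c: "c > 0"
    using a assms by (simp add: c_def)
  have cm: "c \<le> m0\<^sup>2 / 2" "c \<le> a / (?d * \<delta>)"
    unfolding c_def by (rule min.cobounded1 min.cobounded2)+
  show "1 / \<delta> ^ CARD('d) > 0"
    using assms by simp
  show "c > 0"
    by (rule c)
  fix z :: "real \<times> (real ^ 'd)" assume z: "z \<in> Gam \<delta>"
  obtain t x where tx: "z = (t, x)" by (cases z)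
  show "\<bar>green \<delta> m0 z\<bar> \<le> 1 / \<delta> ^ CARD('d) * exp (- c * norm z)"
  proof (cases "t > 0")
    case False
    then show ?thesis
      using assms by (simp add: green_def tx)
  next
    case True
    obtain m :: "int ^ 'd" where m: "x = (\<chi> i. \<delta> * of_int (m $ i))"
      using z by (auto simp: Gam_def lattice_def tx)
    \<comment> \<open>Decay is available in any single coordinate. The largest one controls the norm
      of \<open>x\<close> up to the factor \<open>?d * \<delta>\<close>, which explains the second
      entry of \<open>c\<close>.\<close>
    obtain k where k: "\<And>i. \<bar>m $ i\<bar> \<le> \<bar>m $ k\<bar>"
    proof -
      have "Max (range (\<lambda>i. \<bar>m $ i\<bar>)) \<in> range (\<lambda>i. \<bar>m $ i\<bar>)"
        by (intro Max_in) auto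
      then obtain k where k: "Max (range (\<lambda>i. \<bar>m $ i\<bar>)) = \<bar>m $ k\<bar>"
        by blast
      have "\<bar>m $ i\<bar> \<le> \<bar>m $ k\<bar>" for i
        unfolding k[symmetric] by (rule Max_ge) auto
      then show ?thesis
        by (rule that)
    qed
    have "norm x \<le> (\<Sum>i\<in>UNIV. \<bar>x $ i\<bar>)"
      by (rule norm_le_l1_cart)
    also have "\<dots> \<le> (\<Sum>i\<in>(UNIV :: 'd set). \<delta> * \<bar>m $ k\<bar>)"
      using k assms(1) by (intro sum_mono) (simp add: m abs_mult flip: of_int_abs)
    finally have x: "norm x \<le> ?d * \<delta> * \<bar>m $ k\<bar>"
      by simp
    have "c * norm z \<le> c * (t + norm x)"
      using norm_Pair_le[of t x] c True by (intro mult_left_mono) (auto simp: tx)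
    also have "\<dots> = c * t + c * norm x"
      by (simp add: distrib_left)
    also have "\<dots> \<le> m0\<^sup>2 / 2 * t + a / (?d * \<delta>) * (?d * \<delta> * \<bar>m $ k\<bar>)"
      using x True a assms cm by (intro add_mono mult_mono) simp_all
    also have "\<dots> = m0\<^sup>2 / 2 * t + a * \<bar>m $ k\<bar>"
      using assms by simp
    finally have cz: "c * norm z \<le> m0\<^sup>2 / 2 * t + a * \<bar>m $ k\<bar>" .
    have "\<bar>green \<delta> m0 z\<bar> \<le> norm (heat_kernel_complex \<delta> m0 t x)"
      using True by (simp add: green_def tx heat_kernel_def abs_Re_le_cmod)
    also have "\<dots> \<le> exp (2 * ?d / \<delta>\<^sup>2 * t * (exp a - 1) - m0\<^sup>2 * t - a * \<bar>m $ k\<bar>) / \<delta> ^ CARD('d)"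
      unfolding m using assms True a by (intro norm_heat_kernel_complex_le) auto
    also have "2 * ?d / \<delta>\<^sup>2 * t * (exp a - 1) - m0\<^sup>2 * t - a * \<bar>m $ k\<bar> = - (m0\<^sup>2 / 2 * t + a * \<bar>m $ k\<bar>)"
      using assms by (simp add: exp_a field_simps)
    also have "exp (- (m0\<^sup>2 / 2 * t + a * \<bar>m $ k\<bar>)) / \<delta> ^ CARD('d) \<le> exp (- c * norm z) / \<delta> ^ CARD('d)"
      using cz assms by (intro divide_right_mono) auto
    finally show ?thesis
      by simp
  qed
qed

lemma power_le_exp:
  fixes c :: real
  assumes "c > 0"
  obtains C where "C > 0" and "\<And>r. r \<ge> 0 \<Longrightarrow> (1 + r\<^sup>2) ^ N \<le> C * exp (c * r)"
proof
  \<comment> \<open>The rate \<open>c\<close> is shared among the \<open>N\<close> factors; dividing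
    by \<open>Suc N\<close> also covers \<open>N = 0\<close>.\<close>
  define e where "e = c / Suc N"
  \<comment> \<open>Large enough for \<open>K\<close> times the quadratic Taylor polynomial of
    \<open>exp (e * r)\<close> to dominate both 1 and \<open>r\<^sup>2\<close>.\<close>
  define K where "K = 1 + 2 / e\<^sup>2"
  have e: "e > 0"
    using assms by (simp add: e_def)
  then have K: "K \<ge> 1" "2 / e\<^sup>2 \<le> K"
    by (simp_all add: K_def)
  show "K ^ N > 0"
    using K by simp
  fix r :: real assume r: "r \<ge> 0"
  have "1 + r\<^sup>2 \<le> K * (1 + e * r + (e * r)\<^sup>2 / 2)"
  proof -
    have "r\<^sup>2 = 2 / e\<^sup>2 * ((e * r)\<^sup>2 / 2)"
      using e by (simp add: power_mult_distrib)
    also have "\<dots> \<le> K * ((e * r)\<^sup>2 / 2)"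
      using K by (intro mult_right_mono) auto
    finally have "r\<^sup>2 \<le> K * ((e * r)\<^sup>2 / 2)" .
    moreover have "0 \<le> K * (e * r)"
      using K e r by simp
    ultimately show ?thesis
      using K by (simp add: distrib_left)
  qed
  also have "\<dots> \<le> K * exp (e * r)"
    using K e r by (intro mult_left_mono exp_lower_Taylor_quadratic) auto
  finally have "(1 + r\<^sup>2) ^ N \<le> (K * exp (e * r)) ^ N"
    by (intro power_mono) auto
  also have "\<dots> = K ^ N * exp (N * (e * r))"
    by (simp add: power_mult_distrib exp_of_nat_mult)
  also have "\<dots> \<le> K ^ N * exp (c * r)"
  proof -
    have "N * e \<le> c"
      using assms by (simp add: e_def field_simps)
    then have "N * e * r \<le> c * r"
      using r by (rule mult_right_mono)
    then show ?thesis
      using K by (intro mult_left_mono) (simp_all add: mult.assoc)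
  qed
  finally show "(1 + r\<^sup>2) ^ N \<le> K ^ N * exp (c * r)" .
qed

lemma green_rapid_decay:
  assumes "\<delta> > 0" and "m0 > 0"
  obtains C where "C > 0"
    and "\<And>z. z \<in> Gam \<delta> \<Longrightarrow> \<bar>green \<delta> m0 (z :: real \<times> (real ^ 'd))\<bar> \<le> C / (1 + (norm z)\<^sup>2) ^ N"
proof -
  obtain A c where Ac: "A > 0" "c > 0"
    and le: "\<And>z. z \<in> Gam \<delta> \<Longrightarrow> \<bar>green \<delta> m0 (z :: real \<times> (real ^ 'd))\<bar> \<le> A * exp (- c * norm z)"
    using green_exponential_decay[OF assms] by metis
  obtain C where C: "C > 0" "\<And>r. r \<ge> 0 \<Longrightarrow> (1 + r\<^sup>2) ^ N \<le> C * exp (c * r)"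
    using power_le_exp[OF Ac(2)] by metis
  show ?thesis
  proof
    show "A * C > 0"
      using Ac C by simp
    fix z :: "real \<times> (real ^ 'd)" assume "z \<in> Gam \<delta>"
    then have "\<bar>green \<delta> m0 z\<bar> \<le> A * exp (- c * norm z)"
      by (rule le)
    also have "\<dots> \<le> A * (C / (1 + (norm z)\<^sup>2) ^ N)"
    proof -
      have "exp (- c * norm z) * (1 + (norm z)\<^sup>2) ^ N \<le> exp (- c * norm z) * (C * exp (c * norm z))"
        using C(2)[of "norm z"] by (intro mult_left_mono) auto
      also have "\<dots> = C"
        by (simp add: exp_minus)
      finally show ?thesis
        using Ac one_plus_norm_pos[of z N] by (intro mult_left_mono) (auto simp: pos_le_divide_eq)
    qed
    finally show "\<bar>green \<delta> m0 z\<bar> \<le> A * C / (1 + (norm z)\<^sup>2) ^ N"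
      by simp
  qed
qed

section \<open>Measurability of the heat kernel and the Green function\<close>

lemma heat_kernel_measurable:
  fixes x :: "real ^ 'd"
  shows "(\<lambda>t. heat_kernel \<delta> m0 t x) \<in> borel_measurable borel"
proof -
  have [measurable]: "mu2 \<delta> m0 \<in> borel_measurable (borel :: (real ^ 'd) measure)"
    unfolding mu2_def[abs_def] by measurable
  have "(\<lambda>t. \<integral>p. indicat_real (cbox 0 (\<chi> i. 2 * pi / \<delta>)) p *\<^sub>R
      (exp (- \<i> * of_real (p \<bullet> x)) * of_real (exp (- t * mu2 \<delta> m0 p))) \<partial>lborel) \<in> borel_measurable borel"
    by (rule lborel.borel_measurable_lebesgue_integral) measurable
  then show ?thesis
    unfolding heat_kernel_def heat_kernel_complex_def set_lebesgue_integral_def by measurable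
qed

lemma green_measurable: "green \<delta> m0 \<in> borel_measurable (Gam_measure \<delta> :: (real \<times> (real ^ 'd)) measure)"
proof (rule measurable_Gam_measureI)
  fix x :: "real ^ 'd"
  note heat_kernel_measurable[of \<delta> m0 x, measurable]
  show "(\<lambda>t. green \<delta> m0 (t, x)) \<in> borel_measurable borel"
    unfolding green_def by simp
qed

section \<open>Convolution with the Green function on \<open>Mb\<close>\<close>

lemma peetre_inequality:
  fixes x y :: "'a :: real_normed_vector"
  shows "1 + (norm y)\<^sup>2 \<le> 2 * (1 + (norm x)\<^sup>2) * (1 + (norm (x - y))\<^sup>2)"
proof -
  have "norm y \<le> norm x + norm (x - y)"
    using norm_triangle_sub[of y x] by (simp add: norm_minus_commute)
  then have "(norm y)\<^sup>2 \<le> (norm x + norm (x - y))\<^sup>2"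
    by (intro power_mono) auto
  also have "\<dots> \<le> 2 * (norm x)\<^sup>2 + 2 * (norm (x - y))\<^sup>2"
    using sum_squares_bound[of "norm x" "norm (x - y)"] by (simp add: power2_sum)
  finally have "1 + (norm y)\<^sup>2 \<le> 1 + (2 * (norm x)\<^sup>2 + 2 * (norm (x - y))\<^sup>2)"
    by simp
  also have "1 + (2 * (norm x)\<^sup>2 + 2 * (norm (x - y))\<^sup>2) \<le> 2 * (1 + (norm x)\<^sup>2) * (1 + (norm (x - y))\<^sup>2)"
    by (simp add: distrib_left distrib_right)
  finally show ?thesis
    by simp
qed

text \<open>Peetre's inequality trades decay in \<open>x - y\<close> for decay in \<open>y\<close>,
  at the price of polynomial growth in \<open>x\<close>. Since \<open>N\<close> is arbitrary, it can
  be matched to the weight of any given function in \<open>Mb\<close>.\<close>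

lemma green_diff_le:
  assumes "\<delta> > 0" and "m0 > 0"
  obtains C where "C > 0"
    and "\<And>x y. x \<in> Gam \<delta> \<Longrightarrow> y \<in> Gam \<delta> \<Longrightarrow>
      \<bar>green \<delta> m0 (x - y :: real \<times> (real ^ 'd))\<bar> \<le> C * (1 + (norm x)\<^sup>2) ^ N / (1 + (norm y)\<^sup>2) ^ N"
proof -
  obtain C where C: "C > 0"
    and le: "\<And>z. z \<in> Gam \<delta> \<Longrightarrow> \<bar>green \<delta> m0 (z :: real \<times> (real ^ 'd))\<bar> \<le> C / (1 + (norm z)\<^sup>2) ^ N"
    using green_rapid_decay[OF assms] by metis
  show ?thesis
  proof
    show "C * 2 ^ N > 0"
      using C by simp
    fix x y :: "real \<times> (real ^ 'd)" assume "x \<in> Gam \<delta>" "y \<in> Gam \<delta>"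
    then have "\<bar>green \<delta> m0 (x - y)\<bar> \<le> C / (1 + (norm (x - y))\<^sup>2) ^ N"
      by (intro le Gam_diff)
    also have "\<dots> \<le> C * 2 ^ N * (1 + (norm x)\<^sup>2) ^ N / (1 + (norm y)\<^sup>2) ^ N"
    proof -
      have "(1 + (norm y)\<^sup>2) ^ N \<le> (2 * (1 + (norm x)\<^sup>2) * (1 + (norm (x - y))\<^sup>2)) ^ N"
        by (intro power_mono peetre_inequality) simp
      then have "C * (1 + (norm y)\<^sup>2) ^ N \<le> C * (2 ^ N * (1 + (norm x)\<^sup>2) ^ N * (1 + (norm (x - y))\<^sup>2) ^ N)"
        using C by (intro mult_left_mono) (simp_all only: power_mult_distrib less_imp_le)
      then show ?thesis
        using one_plus_norm_pos[of y N] one_plus_norm_pos[of "x - y" N]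
        by (simp add: divide_le_eq pos_le_divide_eq mult_ac)
    qed
    finally show "\<bar>green \<delta> m0 (x - y)\<bar> \<le> C * 2 ^ N * (1 + (norm x)\<^sup>2) ^ N / (1 + (norm y)\<^sup>2) ^ N" .
  qed
qed

text \<open>With \<open>N\<close> taken from the first moment of \<open>h\<close>, the integrand is
  dominated by \<open>(1 + (norm x)\<^sup>2) ^ N\<close> times a fixed integrable function
  \<open>w\<close>. This gives convergence at every point \<open>x\<close> and polynomial growth of
  the result.\<close>

lemma green_conv_Mb:
  fixes h :: "real \<times> (real ^ 'd) \<Rightarrow> real"
  assumes "\<delta> > 0" and "m0 > 0" and h: "h \<in> Mb \<delta>"
  shows "\<And>x. x \<in> Gam \<delta> \<Longrightarrow> integrable (Gam_measure \<delta>) (\<lambda>y. green \<delta> m0 (x - y) * h y)"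
    and "conv \<delta> (green \<delta> m0) h \<in> Mb \<delta>"
proof -
  let ?G = "Gam_measure \<delta> :: (real \<times> (real ^ 'd)) measure"
  interpret G: sigma_finite_measure ?G
    by (rule sigma_finite_Gam_measure)
  have h_meas: "h \<in> borel_measurable ?G"
    using h by (rule Mb_measurable)
  obtain N where N: "(\<integral>\<^sup>+y. ennreal (\<bar>h y\<bar> ^ 1 / (1 + (norm y)\<^sup>2) ^ N) \<partial>?G) < \<infinity>"
    using h unfolding Mb_def by blast
  define w where "w = (\<lambda>y. \<bar>h y\<bar> / (1 + (norm y)\<^sup>2) ^ N)"
  have w_meas: "w \<in> borel_measurable ?G"
    unfolding w_def
    by (intro borel_measurable_divide borel_measurable_abs h_meas borel_measurable_Gam_measure) measurable
  have w_int: "integrable ?G w"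
    using N w_meas one_plus_norm_pos by (simp add: integrable_iff_bounded w_def abs_of_pos)
  obtain C where C: "C > 0" and le: "\<And>x y. x \<in> Gam \<delta> \<Longrightarrow> y \<in> Gam \<delta> \<Longrightarrow>
      \<bar>green \<delta> m0 (x - y :: real \<times> (real ^ 'd))\<bar> \<le> C * (1 + (norm x)\<^sup>2) ^ N / (1 + (norm y)\<^sup>2) ^ N"
    using green_diff_le[OF assms(1,2)] by metis
  have bound: "\<bar>green \<delta> m0 (x - y) * h y\<bar> \<le> C * (1 + (norm x)\<^sup>2) ^ N * w y" if "x \<in> Gam \<delta>" "y \<in> Gam \<delta>" for x y
  proof -
    have "\<bar>green \<delta> m0 (x - y)\<bar> * \<bar>h y\<bar> \<le> C * (1 + (norm x)\<^sup>2) ^ N / (1 + (norm y)\<^sup>2) ^ N * \<bar>h y\<bar>"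
      using that by (intro mult_right_mono le) auto
    then show ?thesis
      by (simp add: abs_mult w_def)
  qed
  \<comment> \<open>Joint measurability, from which both the sections in \<open>y\<close> and the
    integral as a function of \<open>x\<close> inherit measurability.\<close>
  have meas: "(\<lambda>z. green \<delta> m0 (fst z - snd z) * h (snd z)) \<in> borel_measurable (?G \<Otimes>\<^sub>M ?G)"
    by (intro borel_measurable_times measurable_compose[OF measurable_Gam_measure_diff green_measurable]
        measurable_compose[OF measurable_snd h_meas])
  show int: "integrable ?G (\<lambda>y. green \<delta> m0 (x - y) * h y)" if x: "x \<in> Gam \<delta>" for x
  proof (rule Bochner_Integration.integrable_bound)
    show "integrable ?G (\<lambda>y. C * (1 + (norm x)\<^sup>2) ^ N * w y)"
      by (intro integrable_mult_right w_int)
    have "(\<lambda>y. (x, y)) \<in> measurable ?G (?G \<Otimes>\<^sub>M ?G)"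
      using x by (intro measurable_Pair1') (simp add: space_Gam_measure)
    from measurable_compose[OF this meas]
    show "(\<lambda>y. green \<delta> m0 (x - y) * h y) \<in> borel_measurable ?G"
      by simp
    show "AE y in ?G. norm (green \<delta> m0 (x - y) * h y) \<le> norm (C * (1 + (norm x)\<^sup>2) ^ N * w y)"
      using bound[OF x] by (intro AE_I2) (auto simp: space_Gam_measure intro: order_trans[OF _ abs_ge_self])
  qed
  show "conv \<delta> (green \<delta> m0) h \<in> Mb \<delta>"
  proof (rule Mb_polynomial_growth[OF assms(1)])
    have "(\<lambda>(x, y). green \<delta> m0 (x - y) * h y) \<in> borel_measurable (?G \<Otimes>\<^sub>M ?G)"
      using meas by (simp add: case_prod_beta')
    then show "conv \<delta> (green \<delta> m0) h \<in> borel_measurable ?G"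
      unfolding conv_def[abs_def] by (rule G.borel_measurable_lebesgue_integral)
    fix x :: "real \<times> (real ^ 'd)" assume x: "x \<in> Gam \<delta>"
    have "\<bar>conv \<delta> (green \<delta> m0) h x\<bar> \<le> (\<integral>y. C * (1 + (norm x)\<^sup>2) ^ N * w y \<partial>?G)"
      unfolding conv_def using bound[OF x]
      by (intro integral_abs_bound_integral int[OF x] integrable_mult_right w_int)
        (simp add: space_Gam_measure)
    also have "\<dots> = C * (\<integral>y. w y \<partial>?G) * (1 + (norm x)\<^sup>2) ^ N"
      by simp
    finally show "\<bar>conv \<delta> (green \<delta> m0) h x\<bar> \<le> C * (\<integral>y. w y \<partial>?G) * (1 + (norm x)\<^sup>2) ^ N" .
  qed
qed

text \<open>The heat kernel is bounded uniformly in \<open>t > 0\<close> and \<open>f\<close> is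
  summable on the lattice, so the initial term is even bounded.\<close>

lemma initial_term_Mb:
  fixes f :: "real ^ 'd \<Rightarrow> real"
  assumes "\<delta> > 0" and "m0 > 0" and f: "f \<in> schwartz_lattice \<delta>"
  shows "initial_term \<delta> m0 f \<in> Mb \<delta>"
proof -
  let ?L = "lattice_measure \<delta> :: (real ^ 'd) measure"
  interpret L: sigma_finite_measure ?L
    by (rule sigma_finite_lattice_measure)
  have meas_L: "u \<in> borel_measurable ?L" for u :: "real ^ 'd \<Rightarrow> real"
    by (rule measurableI) simp_all
  define w where "w = (\<lambda>y :: real ^ 'd. 1 / (1 + (norm y)\<^sup>2) ^ CARD('d))"
  have w_int: "integrable ?L w"
    using nn_integral_lattice_weight[OF assms(1), where 'd = 'd] meas_L[of w] one_plus_norm_pos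
    by (simp add: integrable_iff_bounded w_def abs_of_pos)
  \<comment> \<open>With exponent 0 the decay estimate says that \<open>green\<close> is
    bounded.\<close>
  obtain A where A: "A > 0" and green_le: "\<And>z. z \<in> Gam \<delta> \<Longrightarrow> \<bar>green \<delta> m0 (z :: real \<times> (real ^ 'd))\<bar> \<le> A / (1 + (norm z)\<^sup>2) ^ 0"
    using green_rapid_decay[OF assms(1,2)] by metis
  obtain B where B: "\<And>y. y \<in> lattice \<delta> \<Longrightarrow> (1 + (norm y)\<^sup>2) ^ CARD('d) * \<bar>f y\<bar> \<le> B"
    using f unfolding schwartz_lattice_def by blast
  have bound: "\<bar>heat_kernel \<delta> m0 t (x - y) * f y\<bar> \<le> A * B * w y"
    if "t > 0" "x \<in> lattice \<delta>" "y \<in> lattice \<delta>" for t x y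
  proof -
    have "\<bar>heat_kernel \<delta> m0 t (x - y)\<bar> \<le> A"
      using green_le[of "(t, x - y)"] that by (simp add: Gam_def lattice_diff green_def)
    moreover have "\<bar>f y\<bar> \<le> B * w y"
      using B[OF that(3)] one_plus_norm_pos[of y "CARD('d)"] by (simp add: w_def pos_le_divide_eq mult.commute)
    ultimately have "\<bar>heat_kernel \<delta> m0 t (x - y)\<bar> * \<bar>f y\<bar> \<le> A * (B * w y)"
      using A by (intro mult_mono) auto
    then show ?thesis
      by (simp add: abs_mult mult.assoc)
  qed
  show ?thesis
  proof (rule Mb_polynomial_growth[OF assms(1)])
    show "initial_term \<delta> m0 f \<in> borel_measurable (Gam_measure \<delta>)"
    proof (rule measurable_Gam_measureI)
      fix x :: "real ^ 'd" assume "x \<in> lattice \<delta>"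
      have "(\<lambda>z. heat_kernel \<delta> m0 (fst z) (x - snd z) * f (snd z)) \<in> borel_measurable (Gam_measure \<delta>)"
        by (rule measurable_Gam_measureI)
          (simp only: fst_conv snd_conv, intro borel_measurable_times heat_kernel_measurable borel_measurable_const)
      then have "(\<lambda>(t, y). heat_kernel \<delta> m0 t (x - y) * f y) \<in> borel_measurable (lborel \<Otimes>\<^sub>M ?L)"
        by (simp add: Gam_measure_def case_prod_beta')
      then have "(\<lambda>t. lattice_conv \<delta> (heat_kernel \<delta> m0 t) f x) \<in> borel_measurable lborel"
        unfolding lattice_conv_def by (rule L.borel_measurable_lebesgue_integral)
      then show "(\<lambda>t. initial_term \<delta> m0 f (t, x)) \<in> borel_measurable borel"
        by (simp add: initial_term_def)
    qed
    fix z :: "real \<times> (real ^ 'd)" assume z: "z \<in> Gam \<delta>"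
    obtain t x where tx: "z = (t, x)" by (cases z)
    have x: "x \<in> lattice \<delta>"
      using z by (simp add: tx Gam_def)
    have le: "\<bar>lattice_conv \<delta> (heat_kernel \<delta> m0 t) f x\<bar> \<le> (\<integral>y. A * B * w y \<partial>?L)" if "t > 0"
    proof -
      have maj: "integrable ?L (\<lambda>y. A * B * w y)"
        by (intro integrable_mult_right w_int)
      then have "integrable ?L (\<lambda>y. heat_kernel \<delta> m0 t (x - y) * f y)"
        by (rule Bochner_Integration.integrable_bound)
          (use bound[OF that x] in \<open>auto simp: meas_L intro!: AE_I2 intro: order_trans[OF _ abs_ge_self]\<close>)
      then show ?thesis
        unfolding lattice_conv_def using bound[OF that x]
        by (intro integral_abs_bound_integral maj) auto
    qed
    \<comment> \<open>The outer absolute value makes the bound visibly nonnegative, as the case of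
      nonpositive \<open>t\<close>, where the term is 0, requires.\<close>
    have "\<bar>initial_term \<delta> m0 f z\<bar> \<le> \<bar>\<integral>y. A * B * w y \<partial>?L\<bar>"
    proof (cases "t > 0")
      case True
      then show ?thesis
        using order_trans[OF le[OF True] abs_ge_self] by (simp add: initial_term_def tx)
    qed (simp add: initial_term_def tx)
    then show "\<bar>initial_term \<delta> m0 f z\<bar> \<le> \<bar>\<integral>y. A * B * w y \<partial>?L\<bar> * (1 + (norm z)\<^sup>2) ^ 0"
      by simp
  qed
qed

section \<open>The recursion for the coefficients\<close>

lemma multinomial_term_Mb:
  assumes "\<delta> > 0" and "\<And>i. n i \<noteq> 0 \<Longrightarrow> X i \<in> Mb \<delta>"
  shows "multinomial_term p n X \<in> Mb \<delta>"
proof -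
  have "(\<lambda>y. fact p / (\<Prod>i | n i \<noteq> 0. fact (n i)) * (\<Prod>i | n i \<noteq> 0. X i y ^ n i)) \<in> Mb \<delta>"
    using assms by (intro Mb_mult Mb_const Mb_prod Mb_power) auto
  then show ?thesis
    by (simp only: multinomial_term_def[abs_def])
qed

text \<open>By \<open>B_idx_lt\<close> the sum reads only entries below \<open>j\<close>, so an
  approximating sequence may replace the final one.\<close>

lemma multinomial_sum_cong:
  assumes "\<And>i. i < j \<Longrightarrow> X i y = Y i y"
  shows "(\<Sum>n\<in>B_idx p j. multinomial_term p n X y) = (\<Sum>n\<in>B_idx p j. multinomial_term p n Y y)"
proof (rule sum.cong[OF refl])
  fix n assume "n \<in> B_idx p j"
  then have "X i y = Y i y" if "n i \<noteq> 0" for i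
    using that by (intro assms B_idx_lt)
  then have "(\<Prod>i | n i \<noteq> 0. X i y ^ n i) = (\<Prod>i | n i \<noteq> 0. Y i y ^ n i)"
    by (intro prod.cong) auto
  then show "multinomial_term p n X y = multinomial_term p n Y y"
    by (simp only: multinomial_term_def)
qed

definition coefficient_recursion ::
  "real \<Rightarrow> real \<Rightarrow> nat \<Rightarrow> (real ^ 'd \<Rightarrow> real) \<Rightarrow> (real \<times> (real ^ 'd) \<Rightarrow> real) \<Rightarrow>
   (nat \<Rightarrow> real \<times> (real ^ 'd) \<Rightarrow> real) \<Rightarrow> bool" where
  "coefficient_recursion \<delta> m0 p f g X \<longleftrightarrow>
     (\<forall>x\<in>Gam \<delta>. X 0 x = g x + initial_term \<delta> m0 f x) \<and>
     (\<forall>j\<ge>1. \<forall>x\<in>Gam \<delta>. X j x = conv \<delta> (green \<delta> m0) (\<lambda>y. \<Sum>n\<in>B_idx p j. multinomial_term p n X y) x)"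

text \<open>
  The recursion is run on the whole sequence: \<open>W k\<close> holds the correct coefficients below \<open>k\<close>, and
  the diagonal of \<open>W\<close> is the expansion.
\<close>

lemma ex_coefficient_recursion:
  fixes f :: "real ^ 'd \<Rightarrow> real"
  shows "\<exists>X. coefficient_recursion \<delta> m0 p f g X"
proof -
  define step :: "nat \<Rightarrow> (nat \<Rightarrow> real \<times> (real ^ 'd) \<Rightarrow> real) \<Rightarrow> real \<times> (real ^ 'd) \<Rightarrow> real" where
    "step = (\<lambda>j X x. if j = 0 then g x + initial_term \<delta> m0 f x
       else conv \<delta> (green \<delta> m0) (\<lambda>y. \<Sum>n\<in>B_idx p j. multinomial_term p n X y) x)"
  \<comment> \<open>The zero start is a dummy: \<open>step 0\<close> does not look at its sequence,
    and later steps read only entries already filled in.\<close>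
  define W where "W = rec_nat (\<lambda>_ _. 0) (\<lambda>k Z. Z(k := step k Z))"
  have W_Suc: "W (Suc k) = (W k)(k := step k (W k))" for k
    by (simp add: W_def)
  define X where "X = (\<lambda>j. W (Suc j) j)"
  have stable: "W k i = X i" if "i < k" for i k
    using that
  proof (induction k)
    case (Suc k)
    then show ?case
      by (cases "i = k") (auto simp: X_def W_Suc)
  qed simp
  have "X j = step j X" for j
  proof -
    have "(\<Sum>n\<in>B_idx p j. multinomial_term p n (W j) y) = (\<Sum>n\<in>B_idx p j. multinomial_term p n X y)" for y
      by (intro multinomial_sum_cong) (simp add: stable)
    then have "step j (W j) = step j X"
      by (cases "j = 0") (simp_all add: step_def)
    then show ?thesis
      by (simp add: X_def W_Suc)
  qed
  then have "X j x = step j X x" for j x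
    by metis
  then have "X 0 x = g x + initial_term \<delta> m0 f x"
    "j \<ge> 1 \<Longrightarrow> X j x = conv \<delta> (green \<delta> m0) (\<lambda>y. \<Sum>n\<in>B_idx p j. multinomial_term p n X y) x" for j x
    by (simp_all add: step_def)
  then show ?thesis
    unfolding coefficient_recursion_def by blast
qed

text \<open>Strong induction along the recursion. \<open>Mb_cong\<close> enters because the
  recursion determines \<open>X j\<close> on \<open>Gam \<delta>\<close> only.\<close>

lemma coefficient_recursion_Mb:
  fixes f :: "real ^ 'd \<Rightarrow> real"
  assumes "\<delta> > 0" and "m0 > 0" and "f \<in> schwartz_lattice \<delta>" and "g \<in> Mb \<delta>"
    and X: "coefficient_recursion \<delta> m0 p f g X"
  shows "X j \<in> Mb \<delta>"
proof (induction j rule: less_induct)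
  case (less j)
  show ?case
  proof (cases "j = 0")
    case True
    have "(\<lambda>x. g x + initial_term \<delta> m0 f x) \<in> Mb \<delta>"
      using assms by (intro Mb_add initial_term_Mb)
    then show ?thesis
      using X Mb_cong[of \<delta> "X 0" "\<lambda>x. g x + initial_term \<delta> m0 f x"] True
      by (simp add: coefficient_recursion_def)
  next
    case False
    have "(\<lambda>y. \<Sum>n\<in>B_idx p j. multinomial_term p n X y) \<in> Mb \<delta>"
      using less B_idx_lt assms(1) by (intro Mb_sum multinomial_term_Mb) blast+
    then have "conv \<delta> (green \<delta> m0) (\<lambda>y. \<Sum>n\<in>B_idx p j. multinomial_term p n X y) \<in> Mb \<delta>"
      by (rule green_conv_Mb(2)[OF assms(1,2)])
    then show ?thesis
      using X Mb_cong[of \<delta> "X j" "conv \<delta> (green \<delta> m0) (\<lambda>y. \<Sum>n\<in>B_idx p j. multinomial_term p n X y)"] False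
      by (simp add: coefficient_recursion_def)
  qed
qed

lemma coupling_series_equation_iff:
  "coupling_series X x =
      - fps_X * Abs_fps (\<lambda>k. conv \<delta> (green \<delta> m0) (\<lambda>y. fps_nth (coupling_series X y ^ p) k) x)
      + fps_const a + fps_const b \<longleftrightarrow>
    X 0 x = a + b \<and>
    (\<forall>j\<ge>1. X j x = conv \<delta> (green \<delta> m0) (\<lambda>y. \<Sum>n\<in>B_idx p j. multinomial_term p n X y) x)"
proof -
  let ?c = "\<lambda>j. conv \<delta> (green \<delta> m0) (\<lambda>y. \<Sum>n\<in>B_idx p j. multinomial_term p n X y) x"
  \<comment> \<open>The sign comes out of the Bochner integral in any case, a divergent integral
    being 0 on both sides.\<close>
  have conv: "conv \<delta> (green \<delta> m0) (\<lambda>y. fps_nth (coupling_series X y ^ p) k) x = (- 1) ^ k * ?c (Suc k)" for k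
    by (simp add: coupling_series_power_nth conv_def mult.left_commute)
  have nth: "fps_nth (coupling_series X x) j = (- 1) ^ j * X j x" for j
    by (simp add: coupling_series_def)
  have "fps_nth (coupling_series X x) j = fps_nth (- fps_X * Abs_fps (\<lambda>k. conv \<delta> (green \<delta> m0)
      (\<lambda>y. fps_nth (coupling_series X y ^ p) k) x) + fps_const a + fps_const b) j \<longleftrightarrow>
      X j x = (if j = 0 then a + b else ?c j)" for j
    \<comment> \<open>Multiplication by \<open>- fps_X\<close> shifts the index by one, and its sign
      completes \<open>(- 1) ^ k\<close> to \<open>(- 1) ^ Suc k\<close>, which cancels against the
      sign of the coefficient on the left.\<close>
    by (cases j) (simp_all add: conv nth)
  then have "coupling_series X x =
      - fps_X * Abs_fps (\<lambda>k. conv \<delta> (green \<delta> m0) (\<lambda>y. fps_nth (coupling_series X y ^ p) k) x)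
      + fps_const a + fps_const b \<longleftrightarrow> (\<forall>j. X j x = (if j = 0 then a + b else ?c j))"
    unfolding fps_eq_iff by blast
  also have "\<dots> \<longleftrightarrow> X 0 x = a + b \<and> (\<forall>j\<ge>1. X j x = ?c j)"
    by (metis One_nat_def Suc_le_eq neq0_conv)
  finally show ?thesis .
qed

text \<open>The equations agree point by point. What remains is that the recursion forces the
  convergence demanded of a solution: its coefficients lie in the algebra \<open>Mb\<close>, hence
  so do those of the \<open>p\<close>-th power.\<close>

lemma perturbative_solution_iff_coefficient_recursion:
  fixes f :: "real ^ 'd \<Rightarrow> real"
  assumes "\<delta> > 0" and "m0 > 0" and "f \<in> schwartz_lattice \<delta>" and "g \<in> Mb \<delta>"
  shows "perturbative_solution \<delta> m0 p f g X \<longleftrightarrow> coefficient_recursion \<delta> m0 p f g X"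
proof -
  have eq: "perturbative_solution \<delta> m0 p f g X \<longleftrightarrow>
      (\<forall>k. \<forall>x\<in>Gam \<delta>. integrable (Gam_measure \<delta>)
        (\<lambda>y. green \<delta> m0 (x - y) * fps_nth (coupling_series X y ^ p) k)) \<and> coefficient_recursion \<delta> m0 p f g X"
    unfolding perturbative_solution_def coefficient_recursion_def coupling_series_equation_iff by blast
  have "integrable (Gam_measure \<delta>) (\<lambda>y. green \<delta> m0 (x - y) * fps_nth (coupling_series X y ^ p) k)"
    if "coefficient_recursion \<delta> m0 p f g X" "x \<in> Gam \<delta>" for k x
  proof (rule green_conv_Mb(1)[OF assms(1,2) _ that(2)])
    show "(\<lambda>y. fps_nth (coupling_series X y ^ p) k) \<in> Mb \<delta>"
      unfolding coupling_series_power_nth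
      by (intro Mb_mult Mb_const Mb_sum multinomial_term_Mb assms(1) coefficient_recursion_Mb[OF assms that(1)])
  qed
  then show ?thesis
    unfolding eq by blast
qed

theorem proposition2p5:
  fixes \<delta> m0 :: real and p :: nat
    and f :: "real ^ 'd \<Rightarrow> real"
    and M :: "'w measure"
    and \<eta> :: "'w \<Rightarrow> (real \<times> (real ^ 'd) \<Rightarrow> real) \<Rightarrow> real"
    and G\<eta> :: "'w \<Rightarrow> real \<times> (real ^ 'd) \<Rightarrow> real"
  assumes "\<delta> > 0" and "m0 > 0" and "p \<ge> 1"
    and "f \<in> schwartz_lattice \<delta>"
    and "prob_space M" and "noise \<delta> M \<eta>"
    and "AE \<omega> in M. G\<eta> \<omega> \<in> Mb \<delta> \<and> represents \<delta> (G\<eta> \<omega>) (green_conv_dist \<delta> m0 (\<eta> \<omega>))"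
  shows "AE \<omega> in M.
     (\<exists>X. perturbative_solution \<delta> m0 p f (G\<eta> \<omega>) X) \<and>
     (\<forall>X. perturbative_solution \<delta> m0 p f (G\<eta> \<omega>) X \<longleftrightarrow>
        (\<forall>x\<in>Gam \<delta>. X 0 x = G\<eta> \<omega> x + initial_term \<delta> m0 f x) \<and>
        (\<forall>j\<ge>1. \<forall>x\<in>Gam \<delta>.
           X j x = conv \<delta> (green \<delta> m0) (\<lambda>y. \<Sum>n\<in>B_idx p j. multinomial_term p n X y) x)) \<and>
     (\<forall>X. perturbative_solution \<delta> m0 p f (G\<eta> \<omega>) X \<longrightarrow> (\<forall>j. X j \<in> Mb \<delta>))"
  using assms(7)
proof eventually_elim
  case (elim \<omega>)
  then have g: "G\<eta> \<omega> \<in> Mb \<delta>"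
    by blast
  \<comment> \<open>From here on \<open>\<omega>\<close> is fixed and the argument is
    deterministic.\<close>
  note iff = perturbative_solution_iff_coefficient_recursion[OF assms(1,2,4) g]
  show ?case
    using ex_coefficient_recursion[of \<delta> m0 p f "G\<eta> \<omega>"] coefficient_recursion_Mb[OF assms(1,2,4) g]
    unfolding iff coefficient_recursion_def[symmetric] by blast
qed

end
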